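(* Let $H$ be a fixed graph and let $(S,H_1,\dots,H_d)$ be a $d$-separator of $H$. Then $\text{Exact-Weight-}H$ on a graph with $n$ nodes can be reduced to $\tilde O(n^{|S|})$ instances of $d$-sum, each on $\max\{n^{|H_1|},\dots,n^{|H_d|}\}$ numbers.
   Context: $\text{Exact-Weight-}H$: given a graph $G$ with integer edge weights and a target integer $t$, decide whether $G$ contains a (not necessarily induced) subgraph isomorphic to $H$ whose edge weights sum to $t$. The $d$-sum problem: given $d$ lists of integers and a target, decide whether one can choose one integer from each list such that they sum to the target. A tuple $(S,H_1,\dots,H_d)$ of vertex sets is a $d$-separator of $H$ if $S,H_1,\dots,H_d$ partition $V(H)$ and there is no edge of $H$ between a vertex of $H_i$ and a vertex of $H_j$ for distinct $i,j\in[d]$. $\tilde O$ hides polylogarithmic factors; $|V(H)|$ is treated as a constant. *)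

theory Defs
  imports Complex_Main "HOL-Library.Landau_Symbols"
begin

section \<open>Finite simple graphs and Exact-Weight-H\<close>

type_synonym 'a graph = "'a set \<times> 'a set set"

definition simple_graph :: "'a graph \<Rightarrow> bool" where
  "simple_graph G \<longleftrightarrow> finite (fst G) \<and> (\<forall>e\<in>snd G. e \<subseteq> fst G \<and> card e = 2)"

definition subgraph :: "'a graph \<Rightarrow> 'a graph \<Rightarrow> bool" where
  "subgraph G' G \<longleftrightarrow> simple_graph G' \<and> fst G' \<subseteq> fst G \<and> snd G' \<subseteq> snd G"

definition graph_iso :: "'a graph \<Rightarrow> 'b graph \<Rightarrow> bool" where
  "graph_iso G H \<longleftrightarrow> (\<exists>f. bij_betw f (fst G) (fst H) \<and> (`) f ` snd G = snd H)"

definition exact_weight :: "'a graph \<Rightarrow> 'b graph \<Rightarrow> ('b set \<Rightarrow> int) \<Rightarrow> int \<Rightarrow> bool" where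
  "exact_weight H G w t \<longleftrightarrow>
     (\<exists>G'. subgraph G' G \<and> graph_iso G' H \<and> (\<Sum>e\<in>snd G'. w e) = t)"

text \<open>The parts \<open>H\<^sub>1, \<dots>, H\<^sub>d\<close> are the entries of the list \<open>Hs\<close>, so \<open>d = length Hs\<close>.
  Parts may be empty.\<close>

definition separator :: "'a graph \<Rightarrow> 'a set \<Rightarrow> 'a set list \<Rightarrow> bool" where
  "separator H S Hs \<longleftrightarrow>
     S \<union> \<Union>(set Hs) = fst H \<and>
     (\<forall>i<length Hs. S \<inter> Hs ! i = {}) \<and>
     (\<forall>i<length Hs. \<forall>j<length Hs. i \<noteq> j \<longrightarrow>
        Hs ! i \<inter> Hs ! j = {} \<and> (\<forall>x\<in>Hs ! i. \<forall>y\<in>Hs ! j. {x, y} \<notin> snd H))"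


section \<open>The d-sum problem\<close>

text \<open>An instance consists of the lists and the target; \<open>d\<close> is the number of lists.\<close>

type_synonym dsum_inst = "int list list \<times> int"

definition dsum :: "dsum_inst \<Rightarrow> bool" where
  "dsum I \<longleftrightarrow> (\<exists>xs. list_all2 (\<lambda>x L. x \<in> set L) xs (fst I) \<and> sum_list xs = snd I)"


section \<open>Word RAM programs that output d-sum instances\<close>

text \<open>A unit-cost word RAM, presented as a structured language over registers and a
  random-access memory. Every value that occurs during an execution, intermediate values
  and addresses included, must lie between \<open>-B\<close> and \<open>B\<close>; a program that leaves this range
  is stuck. The output device is write-only: \<open>Put i e\<close> appends a number to the \<open>i\<close>-th list
  (counted from 0) of the instance under construction, and \<open>Emit e\<close> completes that instance
  with target \<open>e\<close> and starts a fresh one.\<close>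

datatype bop = Add | Sub | Mul | Div | Mod | Less | Equal

datatype expr = Lit int | Reg nat | Mem expr | Bin bop expr expr

datatype com =
    Skip
  | Assign nat expr
  | Store expr expr
  | Put nat expr
  | Emit expr
  | Seq com com
  | Cond expr com com
  | While expr com

record state =
  reg :: "nat \<Rightarrow> int"
  mem :: "int \<Rightarrow> int"
  cur :: "int list list"
  out :: "dsum_inst list"

fun binop :: "bop \<Rightarrow> int \<Rightarrow> int \<Rightarrow> int" where
  "binop Add x y = x + y"
| "binop Sub x y = x - y"
| "binop Mul x y = x * y"
| "binop Div x y = x div y"
| "binop Mod x y = x mod y"
| "binop Less x y = of_bool (x < y)"
| "binop Equal x y = of_bool (x = y)"

fun eval :: "expr \<Rightarrow> state \<Rightarrow> int" where
  "eval (Lit k) s = k"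
| "eval (Reg r) s = reg s r"
| "eval (Mem e) s = mem s (eval e s)"
| "eval (Bin f e1 e2) s = binop f (eval e1 s) (eval e2 s)"

fun subexprs :: "expr \<Rightarrow> expr set" where
  "subexprs (Lit k) = {Lit k}"
| "subexprs (Reg r) = {Reg r}"
| "subexprs (Mem e) = insert (Mem e) (subexprs e)"
| "subexprs (Bin f e1 e2) = insert (Bin f e1 e2) (subexprs e1 \<union> subexprs e2)"

definition fits :: "int \<Rightarrow> expr \<Rightarrow> state \<Rightarrow> bool" where
  "fits B e s \<longleftrightarrow> (\<forall>e'\<in>subexprs e. \<bar>eval e' s\<bar> \<le> B)"

fun cost :: "expr \<Rightarrow> nat" where
  "cost (Lit k) = 1"
| "cost (Reg r) = 1"
| "cost (Mem e) = 1 + cost e"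
| "cost (Bin f e1 e2) = 1 + cost e1 + cost e2"

text \<open>\<open>exec B c s m s'\<close>: started in \<open>s\<close>, the program \<open>c\<close> terminates in \<open>s'\<close> after \<open>m\<close> steps.\<close>

inductive exec :: "int \<Rightarrow> com \<Rightarrow> state \<Rightarrow> nat \<Rightarrow> state \<Rightarrow> bool" for B where
  Skip: "exec B Skip s 1 s"
| Assign: "fits B e s \<Longrightarrow>
    exec B (Assign r e) s (1 + cost e) (s\<lparr>reg := (reg s)(r := eval e s)\<rparr>)"
| Store: "fits B a s \<Longrightarrow> fits B e s \<Longrightarrow>
    exec B (Store a e) s (1 + cost a + cost e) (s\<lparr>mem := (mem s)(eval a s := eval e s)\<rparr>)"
| Put: "fits B e s \<Longrightarrow> i < length (cur s) \<Longrightarrow>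
    exec B (Put i e) s (1 + cost e) (s\<lparr>cur := (cur s)[i := (cur s ! i) @ [eval e s]]\<rparr>)"
| Emit: "fits B e s \<Longrightarrow>
    exec B (Emit e) s (1 + cost e)
      (s\<lparr>cur := replicate (length (cur s)) [], out := out s @ [(cur s, eval e s)]\<rparr>)"
| Seq: "exec B c1 s m1 s1 \<Longrightarrow> exec B c2 s1 m2 s2 \<Longrightarrow> exec B (Seq c1 c2) s (m1 + m2) s2"
| CondTrue: "fits B e s \<Longrightarrow> eval e s \<noteq> 0 \<Longrightarrow> exec B c1 s m s1 \<Longrightarrow>
    exec B (Cond e c1 c2) s (1 + cost e + m) s1"
| CondFalse: "fits B e s \<Longrightarrow> eval e s = 0 \<Longrightarrow> exec B c2 s m s2 \<Longrightarrow>
    exec B (Cond e c1 c2) s (1 + cost e + m) s2"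
| WhileTrue: "fits B e s \<Longrightarrow> eval e s \<noteq> 0 \<Longrightarrow> exec B c s m1 s1 \<Longrightarrow>
    exec B (While e c) s1 m2 s2 \<Longrightarrow> exec B (While e c) s (1 + cost e + m1 + m2) s2"
| WhileFalse: "fits B e s \<Longrightarrow> eval e s = 0 \<Longrightarrow>
    exec B (While e c) s (1 + cost e) s"

text \<open>Input format for a graph with vertices \<open>0, \<dots>, n - 1\<close>: register 0 holds \<open>n\<close>, register 1
  the target; the first \<open>n\<^sup>2\<close> memory cells hold the adjacency matrix, the next \<open>n\<^sup>2\<close> cells
  the weight matrix, both row by row. Everything else is 0.\<close>

definition input_memory :: "nat \<Rightarrow> nat set set \<Rightarrow> (nat set \<Rightarrow> int) \<Rightarrow> int \<Rightarrow> int" where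
  "input_memory n E w a =
     (let e = (\<lambda>k. {k div n, k mod n}) in
      if a < 0 then 0
      else if nat a < n * n then of_bool (e (nat a) \<in> E)
      else if nat a < 2 * n * n \<and> e (nat a - n * n) \<in> E then w (e (nat a - n * n))
      else 0)"

definition initial :: "nat \<Rightarrow> nat \<Rightarrow> nat set set \<Rightarrow> (nat set \<Rightarrow> int) \<Rightarrow> int \<Rightarrow> state" where
  "initial d n E w t =
     \<lparr>reg = (\<lambda>_. 0)(0 := int n, 1 := t), mem = input_memory n E w,
      cur = replicate d [], out = []\<rparr>"


section \<open>Reductions\<close>

definition soft_O :: "(nat \<Rightarrow> real) \<Rightarrow> (nat \<Rightarrow> real) set" where
  "soft_O f = {g. \<exists>k::nat. g \<in> O(\<lambda>n. f n * ln (real n) ^ k)}"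

text \<open>Exact-Weight-\<open>H\<close> on \<open>n\<close> nodes reduces to \<open>soft_O (N n)\<close> instances of \<open>d\<close>-sum, each
  consisting of \<open>d\<close> lists with at most \<open>M n\<close> numbers: a single program, chosen
  before the input graph and \<open>n\<close>, outputs instances at least one of which is solvable iff the given instance
  is. Its running time is, up to polylogarithmic factors, the size \<open>N n * M n\<close> of the output.
  Words have \<open>c * log (n + W + 2)\<close> bits for a constant \<open>c\<close>, where \<open>W\<close> bounds the absolute values
  of the weights and of the target. Without the bounds on time and word length the program could
  solve the problem itself and output a trivial instance.\<close>

definition exact_weight_reduces_to_dsum ::
    "'a graph \<Rightarrow> nat \<Rightarrow> (nat \<Rightarrow> nat) \<Rightarrow> (nat \<Rightarrow> nat) \<Rightarrow> bool" where
  "exact_weight_reduces_to_dsum H d N M \<longleftrightarrow>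
     (\<exists>(P :: com) (c :: nat) (\<nu> :: nat \<Rightarrow> real) (\<tau> :: nat \<Rightarrow> real).
        \<nu> \<in> soft_O (\<lambda>n. real (N n)) \<and>
        \<tau> \<in> soft_O (\<lambda>n. real (N n * M n)) \<and>
        (\<forall>(n :: nat) (E :: nat set set) (w :: nat set \<Rightarrow> int) (t :: int) (W :: nat).
           simple_graph ({..<n}, E) \<longrightarrow> \<bar>t\<bar> \<le> int W \<longrightarrow> (\<forall>e\<in>E. \<bar>w e\<bar> \<le> int W) \<longrightarrow>
           (\<exists>m s. exec (int ((n + W + 2) ^ c)) P (initial d n E w t) m s \<and>
                  real m \<le> \<tau> n \<and>
                  real (length (out s)) \<le> \<nu> n \<and>
                  (\<forall>I\<in>set (out s). length (fst I) = d \<and> (\<forall>L\<in>set (fst I). length L \<le> M n)) \<and>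
                  (exact_weight H ({..<n}, E) w t \<longleftrightarrow> (\<exists>I\<in>set (out s). dsum I)))))"

end

(*
A copy of H is an assignment of distinct vertices of G to the vertices of H. Once the images of S
are fixed, the parts contribute independently to adjacency and weight, but injectivity still couples
the images of different parts. To decouple it, guess for every ordered pair (u, v) of distinct
vertices of H a bit position and a bit b, and demand that the image of u has bit b and the image of
v has bit 1 - b at this position. These are conditions on single vertices, they force injectivity,
and every injective assignment satisfies them for some guess. A guess is one of (2 L)^p values, where
L is the bit length of n and p the number of pairs, so there are n^|S| polylog(n) instances: one for
each pair of an assignment of S and a guess. The i-th list of an instance contains the weights of the
admissible assignments of the i-th part.
*)

theory Submission
  imports Defs
begin

section \<open>Running programs\<close>

text \<open>The obstacle is that one program and one word-length exponent must serve every input,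
  within a time equal to the output size up to logarithms. An edge inside \<open>S\<close> belongs
  to every part, so its weight is subtracted from the target instead of being entered in the lists.
  Conditions on \<open>S\<close> alone are repeated in every part: a bad assignment of
  \<open>S\<close> then empties all lists, which requires at least one part. A copy may be found
  under many guesses, which is harmless because only the existence of a solvable instance matters.
  Assignments and guesses are digits of counters, so nested loops whose depth would depend on
  \<open>H\<close> collapse into one loop per counter. Testing one candidate costs a constant that
  depends on \<open>H\<close> only; hence the time is governed by the number of candidates before
  filtering. All expressions of the program are fixed with \<open>H\<close>. Once registers and
  memory are bounded by a power of \<open>n + W + 2\<close>, an exponent for all intermediate values
  can be read off from the syntax.\<close>

definition state_bounded :: "int \<Rightarrow> state \<Rightarrow> bool" where
  "state_bounded b s \<longleftrightarrow> (\<forall>r. \<bar>reg s r\<bar> \<le> b) \<and> (\<forall>x. \<bar>mem s x\<bar> \<le> b)"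

text \<open>Reduces the word-length condition on a fixed program to a syntactic degree count.\<close>

fun expr_deg :: "nat \<Rightarrow> expr \<Rightarrow> nat" where
  "expr_deg a (Lit k) = nat \<bar>k\<bar>"
| "expr_deg a (Reg r) = a"
| "expr_deg a (Mem e) = a + expr_deg a e"
| "expr_deg a (Bin f e1 e2) = expr_deg a e1 + expr_deg a e2 + 1"

text \<open>For nonzero \<open>y\<close> the exact quotient lies between the integers
  \<open>-\<bar>x\<bar>\<close> and \<open>\<bar>x\<bar>\<close>, and rounding down cannot leave an
  interval with integer ends. Division by zero yields 0.\<close>

lemma abs_div_le: "\<bar>x div y\<bar> \<le> \<bar>x\<bar>" for x y :: int
proof -
  have pos: "\<bar>x div y\<bar> \<le> \<bar>x\<bar>" if "y > 0" for x y :: int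
    using that by (smt (verit) div_by_1 pos_imp_zdiv_neg_iff zdiv_mono2 zdiv_mono2_neg)
  show ?thesis
    using pos[of y x] pos[of "- y" "- x"] by (cases y "0 :: int" rule: linorder_cases) simp_all
qed

text \<open>The factor 2 is due to sums and differences: \<open>b + c \<le> 2 * (b * c)\<close> as
  soon as both bounds are at least 1.\<close>

lemma binop_bound:
  fixes x y b c :: int
  assumes "\<bar>x\<bar> \<le> b" "\<bar>y\<bar> \<le> c" "1 \<le> b" "1 \<le> c"
  shows "\<bar>binop f x y\<bar> \<le> 2 * (b * c)"
proof -
  define p where "p = b * c"
  have p: "b \<le> p" "c \<le> p"
    using assms by (auto simp: p_def mult_le_cancel_left1 mult_le_cancel_right1)
  have "\<bar>x * y\<bar> \<le> p"
    using mult_mono[OF assms(1,2)] assms by (simp add: abs_mult p_def)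
  moreover have "\<bar>x mod y\<bar> \<le> \<bar>x\<bar> \<or> \<bar>x mod y\<bar> \<le> \<bar>y\<bar>"
    by (cases "y = 0") (auto simp: abs_mod_less less_imp_le)
  ultimately show ?thesis
    using p assms abs_div_le[of x y] abs_triangle_ineq[of x y] abs_triangle_ineq4[of x y]
    by (cases f) (simp_all only: binop.simps flip: p_def, auto simp: of_bool_def)
qed

text \<open>The base is at least 2, so the factor 2 of an operation is paid by one more power of
  \<open>X\<close>, and a literal \<open>k\<close> is below the power with exponent
  \<open>\<bar>k\<bar>\<close>.\<close>

lemma eval_bound:
  assumes "2 \<le> X" "state_bounded (X ^ a) s"
  shows "\<bar>eval e s\<bar> \<le> X ^ expr_deg a e"
proof (induction e)
  case (Lit k)
  have "\<bar>k\<bar> \<le> int (2 ^ nat \<bar>k\<bar>)"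
    using of_nat_less_two_power[of "nat \<bar>k\<bar>", where 'a = int] by simp
  also have "\<dots> \<le> X ^ nat \<bar>k\<bar>"
    using power_mono[of 2 X "nat \<bar>k\<bar>"] assms by simp
  finally show ?case by simp
next
  case (Mem e)
  \<comment> \<open>The cell alone would have degree \<open>a\<close>; the degree of its address is
    added so that an expression dominates its subexpressions.\<close>
  have "X ^ a \<le> X ^ (a + expr_deg a e)"
    using assms by (intro power_increasing) auto
  then show ?case using assms by (auto simp: state_bounded_def intro: order_trans)
next
  case (Bin f e1 e2)
  have "\<bar>eval (Bin f e1 e2) s\<bar> \<le> 2 * (X ^ expr_deg a e1 * X ^ expr_deg a e2)"
    using Bin binop_bound[of _ "X ^ expr_deg a e1" _ "X ^ expr_deg a e2"] assms by simp
  also have "\<dots> \<le> X * (X ^ expr_deg a e1 * X ^ expr_deg a e2)"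
    using assms by (intro mult_right_mono) auto
  finally show ?case by (simp add: power_add ac_simps)
qed (use assms in \<open>auto simp: state_bounded_def\<close>)

lemma expr_deg_subexpr: "e' \<in> subexprs e \<Longrightarrow> expr_deg a e' \<le> expr_deg a e"
  by (induction e) auto

lemma fits_if_expr_deg:
  assumes "2 \<le> X" "state_bounded (X ^ a) s" "expr_deg a e \<le> c"
  shows "fits (X ^ c) e s"
  unfolding fits_def
proof
  fix e' assume "e' \<in> subexprs e"
  then have "X ^ expr_deg a e' \<le> X ^ c"
    using expr_deg_subexpr[of e' e a] assms by (intro power_increasing) auto
  then show "\<bar>eval e' s\<bar> \<le> X ^ c"
    using eval_bound[OF assms(1,2), of e'] by linarith
qed

text \<open>An upper bound on the step count, so that the two branches of a conditional and all
  rounds of a loop can share one number.\<close>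

definition runs :: "int \<Rightarrow> com \<Rightarrow> state \<Rightarrow> nat \<Rightarrow> state \<Rightarrow> bool" where
  "runs B c s T s' \<longleftrightarrow> (\<exists>m\<le>T. exec B c s m s')"

lemma runs_Skip: "1 \<le> T \<Longrightarrow> runs B Skip s T s"
  unfolding runs_def using exec.Skip by blast

lemma runs_Assign:
  assumes "fits B e s" "s' = s\<lparr>reg := (reg s)(r := eval e s)\<rparr>" "1 + cost e \<le> T"
  shows "runs B (Assign r e) s T s'"
  unfolding runs_def using assms exec.Assign by blast

lemma runs_Store:
  assumes "fits B a s" "fits B e s" "s' = s\<lparr>mem := (mem s)(eval a s := eval e s)\<rparr>"
    "1 + cost a + cost e \<le> T"
  shows "runs B (Store a e) s T s'"
  unfolding runs_def using assms exec.Store by blast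

lemma runs_Put:
  assumes "fits B e s" "i < length (cur s)"
    "s' = s\<lparr>cur := (cur s)[i := (cur s ! i) @ [eval e s]]\<rparr>" "1 + cost e \<le> T"
  shows "runs B (Put i e) s T s'"
  unfolding runs_def using assms exec.Put by blast

lemma runs_Emit:
  assumes "fits B e s"
    "s' = s\<lparr>cur := replicate (length (cur s)) [], out := out s @ [(cur s, eval e s)]\<rparr>"
    "1 + cost e \<le> T"
  shows "runs B (Emit e) s T s'"
  unfolding runs_def using assms exec.Emit by blast

lemma runs_Seq:
  assumes "runs B c1 s T1 s1" "runs B c2 s1 T2 s2" "T1 + T2 \<le> T"
  shows "runs B (Seq c1 c2) s T s2"
  using assms exec.Seq unfolding runs_def by (meson add_mono order_trans)

lemma runs_Cond:
  assumes "fits B e s" "eval e s \<noteq> 0 \<Longrightarrow> runs B c1 s T' s'"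
    "eval e s = 0 \<Longrightarrow> runs B c2 s T' s'" "1 + cost e + T' \<le> T"
  shows "runs B (Cond e c1 c2) s T s'"
proof (cases "eval e s = 0")
  case True
  then obtain m where "m \<le> T'" "exec B c2 s m s'" using assms unfolding runs_def by blast
  then show ?thesis
    using CondFalse[OF assms(1) True] assms(4) unfolding runs_def by (meson add_left_mono order_trans)
next
  case False
  then obtain m where "m \<le> T'" "exec B c1 s m s'" using assms unfolding runs_def by blast
  then show ?thesis
    using CondTrue[OF assms(1) False] assms(4) unfolding runs_def by (meson add_left_mono order_trans)
qed

text \<open>A loop whose number of rounds is known beforehand: \<open>st j\<close> is the full state
  after \<open>j\<close> rounds and takes the place of an invariant.\<close>

lemma runs_While:
  fixes st :: "nat \<Rightarrow> state"
  assumes "\<And>j. j \<le> N \<Longrightarrow> fits B e (st j)" "\<And>j. j < N \<Longrightarrow> eval e (st j) \<noteq> 0" "eval e (st N) = 0"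
    "\<And>j. j < N \<Longrightarrow> runs B c (st j) T' (st (Suc j))"
    "N * (1 + cost e + T') + (1 + cost e) \<le> T"
  shows "runs B (While e c) (st 0) T (st N)"
proof -
  \<comment> \<open>The induction is on the number of remaining rounds, because \<open>exec\<close>
    unfolds a loop at its front.\<close>
  have "k \<le> N \<Longrightarrow> runs B (While e c) (st (N - k)) (k * (1 + cost e + T') + (1 + cost e)) (st N)" for k
  proof (induction k)
    case 0
    then show ?case unfolding runs_def using WhileFalse assms(1,3) by (metis diff_zero le_add2 le_refl)
  next
    case (Suc k)
    let ?j = "N - Suc k"
    have j: "?j < N" "Suc ?j = N - k" using Suc.prems by auto
    obtain m1 where m1: "m1 \<le> T'" "exec B c (st ?j) m1 (st (Suc ?j))"
      using assms(4)[OF j(1)] unfolding runs_def by blast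
    obtain m2 where m2: "m2 \<le> k * (1 + cost e + T') + (1 + cost e)"
      "exec B (While e c) (st (Suc ?j)) m2 (st N)"
      using Suc unfolding runs_def j(2) by auto
    have "exec B (While e c) (st ?j) (1 + cost e + m1 + m2) (st N)"
      using WhileTrue[OF assms(1) assms(2) m1(2) m2(2)] j by auto
    moreover have "1 + cost e + m1 + m2 \<le> Suc k * (1 + cost e + T') + (1 + cost e)"
      using m1 m2 by simp
    ultimately show ?case unfolding runs_def by blast
  qed
  from this[of N] show ?thesis using assms(5) unfolding runs_def by (auto intro: order_trans)
qed

fun seqs :: "com list \<Rightarrow> com" where
  "seqs [] = Skip"
| "seqs (c # cs) = Seq c (seqs cs)"

lemma runs_seqs:
  assumes "\<And>i. i < length cs \<Longrightarrow> runs B (cs ! i) (st i) T' (st (Suc i))"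
    "length cs * T' + 1 \<le> T"
  shows "runs B (seqs cs) (st 0) T (st (length cs))"
  using assms
proof (induction cs arbitrary: st T)
  case Nil
  then show ?case by (simp add: runs_Skip)
next
  case (Cons c cs)
  have "runs B (seqs cs) (st (Suc 0)) (length cs * T' + 1) (st (Suc (length cs)))"
    by (rule Cons.IH[of "\<lambda>i. st (Suc i)"]) (use Cons.prems(1)[of "Suc _"] in auto)
  then show ?case
    using Cons.prems(1)[of 0] Cons.prems(2) by (auto intro: runs_Seq)
qed

section \<open>Compound expressions\<close>

fun powE :: "expr \<Rightarrow> nat \<Rightarrow> expr" where
  "powE e 0 = Lit 1"
| "powE e (Suc k) = Bin Mul e (powE e k)"

fun sumE :: "expr list \<Rightarrow> expr" where
  "sumE [] = Lit 0"
| "sumE (e # es) = Bin Add e (sumE es)"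

text \<open>Serves as conjunction: the product is nonzero iff every factor is.\<close>

fun prodE :: "expr list \<Rightarrow> expr" where
  "prodE [] = Lit 1"
| "prodE (e # es) = Bin Mul e (prodE es)"

text \<open>A tuple of fixed length is stored as one number and read off digit by digit, so that a
  single counter runs through all tuples.\<close>

definition digit :: "nat \<Rightarrow> nat \<Rightarrow> nat \<Rightarrow> nat" where
  "digit b x i = x div b ^ i mod b"

definition digitE :: "expr \<Rightarrow> expr \<Rightarrow> nat \<Rightarrow> expr" where
  "digitE b x i = Bin Mod (Bin Div x (powE b i)) b"

lemma eval_powE [simp]: "eval (powE e k) s = eval e s ^ k"
  by (induction k) auto

lemma eval_sumE [simp]: "eval (sumE es) s = (\<Sum>e\<leftarrow>es. eval e s)"
  by (induction es) auto

lemma eval_prodE_eq_0_iff: "eval (prodE es) s = 0 \<longleftrightarrow> (\<exists>e\<in>set es. eval e s = 0)"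
  by (induction es) auto

lemma eval_digitE:
  "eval b s = int m \<Longrightarrow> eval x s = int k \<Longrightarrow> eval (digitE b x i) s = int (digit m k i)"
  by (simp add: digitE_def digit_def zdiv_int zmod_int)

lemma ex_digits:
  assumes "\<And>i. i < k \<Longrightarrow> f i < b"
  shows "\<exists>x<b ^ k. \<forall>i<k. digit b x i = f i"
  using assms
proof (induction k)
  case 0
  then show ?case by simp
next
  case (Suc k)
  then obtain x where x: "x < b ^ k" "\<forall>i<k. digit b x i = f i" by auto
  have b: "b > 0" using Suc.prems[of 0] by simp
  have fk: "f k < b" using Suc.prems by simp
  let ?y = "x + f k * b ^ k"
  have "?y < b ^ k + f k * b ^ k" using x by simp
  also have "\<dots> = (f k + 1) * b ^ k" by simp
  also have "\<dots> \<le> b * b ^ k" using fk by (intro mult_right_mono) auto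
  finally have "?y < b ^ Suc k" by simp
  moreover have "digit b ?y i = f i" if "i < Suc k" for i
  proof (cases "i = k")
    case True
    then show ?thesis using x b fk by (simp add: digit_def)
  next
    case False
    then have i: "i < k" using that by simp
    then obtain m where k: "k = Suc (i + m)" using less_imp_Suc_add by blast
    \<comment> \<open>The new leading term is a multiple of \<open>b * b ^ i\<close>, hence
      invisible to digit \<open>i\<close>.\<close>
    have "?y = x + (b * (f k * b ^ m)) * b ^ i" by (simp add: k power_add)
    then have "?y div b ^ i = b * (f k * b ^ m) + x div b ^ i"
      using b div_mult_self1[of "b ^ i" x "b * (f k * b ^ m)"] by (simp only:) simp
    then have "digit b ?y i = digit b x i" by (simp add: digit_def)
    then show ?thesis using x i by simp
  qed
  ultimately show ?case by blast
qed

lemma digit_less: "b > 0 \<Longrightarrow> digit b x i < b"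
  by (simp add: digit_def)

section \<open>Bit length, and bits that tell two numbers apart\<close>

definition bitlen :: "nat \<Rightarrow> nat" where
  "bitlen n = (LEAST j. n < 2 ^ j)"

lemma less_two_power_bitlen: "n < 2 ^ bitlen n"
  unfolding bitlen_def by (rule LeastI[of _ n]) (rule less_exp)

lemma two_power_le_if_less_bitlen: "j < bitlen n \<Longrightarrow> 2 ^ j \<le> n"
  unfolding bitlen_def using not_less_Least not_less by blast

lemma bitlen_le: "bitlen n \<le> n"
  unfolding bitlen_def by (rule Least_le) (rule less_exp)

lemma two_power_bitlen_le: "2 ^ bitlen n \<le> 2 * n + 1"
proof (cases "bitlen n")
  case (Suc j)
  then show ?thesis using two_power_le_if_less_bitlen[of j n] by simp
qed simp

text \<open>Distinct numbers differ in some bit, and all bits of numbers below \<open>n\<close> at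
  positions from \<open>bitlen n\<close> on vanish. This makes a logarithmic number of guesses per
  pair sufficient.\<close>

lemma ex_distinguishing_bit:
  fixes x y :: nat
  assumes "x < n" "y < n" "x \<noteq> y"
  shows "\<exists>j<bitlen n. x div 2 ^ j mod 2 \<noteq> y div 2 ^ j mod 2"
proof -
  obtain j where j: "bit x j \<noteq> bit y j" using assms(3) bit_eq_iff by blast
  have "j < bitlen n"
  proof (rule ccontr)
    assume "\<not> j < bitlen n"
    then have "(2::nat) ^ bitlen n \<le> 2 ^ j" by simp
    then have "x < 2 ^ j" "y < 2 ^ j" using assms less_two_power_bitlen[of n] by linarith+
    then show False using j by (simp add: bit_iff_odd)
  qed
  then show ?thesis using j by (auto simp: bit_iff_odd odd_iff_mod_2_eq_one)
qed

section \<open>Embeddings and d-sum instances\<close>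

text \<open>\<open>graph_iso\<close> maps the copy to \<open>H\<close>; the embedding is the inverse
  map. Edges are recovered from their images by that inverse, so the two weight sums range over
  corresponding edges.\<close>

lemma exact_weight_iff_embedding:
  assumes "simple_graph H" "simple_graph G"
  shows "exact_weight H G w t \<longleftrightarrow>
    (\<exists>f. inj_on f (fst H) \<and> f ` fst H \<subseteq> fst G \<and> (\<forall>e\<in>snd H. f ` e \<in> snd G) \<and>
      (\<Sum>e\<in>snd H. w (f ` e)) = t)"
proof
  assume "exact_weight H G w t"
  then obtain G' f where G': "subgraph G' G" "(\<Sum>e\<in>snd G'. w e) = t"
    and f: "bij_betw f (fst G') (fst H)" "(`) f ` snd G' = snd H"
    unfolding exact_weight_def graph_iso_def by blast
  have sub: "e \<subseteq> fst G'" if "e \<in> snd G'" for e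
    using G' that by (auto simp: subgraph_def simple_graph_def)
  define g where "g = inv_into (fst G') f"
  have gf: "g ` f ` e = e" if "e \<in> snd G'" for e
    using sub[OF that] bij_betw_imp_inj_on[OF f(1)] unfolding g_def by (simp add: inv_into_image_cancel)
  have g: "bij_betw g (fst H) (fst G')"
    using f(1) unfolding g_def by (rule bij_betw_inv_into)
  have "bij_betw ((`) f) (snd G') (snd H)"
    using f(2) gf by (metis bij_betw_def inj_on_inverseI)
  then have "(\<Sum>e\<in>snd H. w (g ` e)) = (\<Sum>e\<in>snd G'. w (g ` f ` e))"
    by (rule sum.reindex_bij_betw[symmetric])
  also have "\<dots> = t" using gf G'(2) by simp
  finally have "(\<Sum>e\<in>snd H. w (g ` e)) = t" .
  moreover have "\<forall>e\<in>snd H. g ` e \<in> snd G"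
    using gf G'(1) unfolding f(2)[symmetric] subgraph_def by auto
  moreover have "inj_on g (fst H)" "g ` fst H \<subseteq> fst G"
    using g G'(1) by (auto simp: bij_betw_def subgraph_def)
  ultimately show "\<exists>f. inj_on f (fst H) \<and> f ` fst H \<subseteq> fst G \<and> (\<forall>e\<in>snd H. f ` e \<in> snd G) \<and>
      (\<Sum>e\<in>snd H. w (f ` e)) = t" by blast
next
  assume "\<exists>f. inj_on f (fst H) \<and> f ` fst H \<subseteq> fst G \<and> (\<forall>e\<in>snd H. f ` e \<in> snd G) \<and>
      (\<Sum>e\<in>snd H. w (f ` e)) = t"
  then obtain f where f: "inj_on f (fst H)" "f ` fst H \<subseteq> fst G" "\<And>e. e \<in> snd H \<Longrightarrow> f ` e \<in> snd G"
    "(\<Sum>e\<in>snd H. w (f ` e)) = t" by blast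
  have H: "e \<subseteq> fst H" "card e = 2" if "e \<in> snd H" for e
    using assms(1) that by (auto simp: simple_graph_def)
  define g where "g = inv_into (fst H) f"
  have gf: "g ` f ` e = e" if "e \<in> snd H" for e
    using H(1)[OF that] f(1) unfolding g_def by (simp add: inv_into_image_cancel)
  let ?G' = "(f ` fst H, (`) f ` snd H)"
  have "card (f ` e) = 2" if "e \<in> snd H" for e
    using H[OF that] f(1) by (metis card_image inj_on_subset)
  then have "subgraph ?G' G"
    using f H(1) assms(1) by (auto simp: subgraph_def simple_graph_def subset_iff)
  moreover have "graph_iso ?G' H"
    unfolding graph_iso_def
  proof (intro exI conjI)
    show "bij_betw g (fst ?G') (fst H)"
      using f(1) unfolding g_def by (simp add: bij_betw_inv_into inj_on_imp_bij_betw)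
    show "(`) g ` snd ?G' = snd H"
      using gf by (auto simp: image_image)
  qed
  moreover have "(\<Sum>e\<in>snd ?G'. w e) = t"
  proof -
    have "inj_on ((`) f) (snd H)" using gf by (metis inj_on_inverseI)
    then show ?thesis using f(4) by (simp add: sum.reindex)
  qed
  ultimately show "exact_weight H G w t" unfolding exact_weight_def by blast
qed

text \<open>Passes from the chosen numbers to indices of the candidates behind them, since different
  candidates may contribute equal numbers.\<close>

lemma dsum_map_iff:
  "dsum (map (\<lambda>X. map (wt X) (filter (ok X) [0..<N X])) Xs, t) \<longleftrightarrow>
    (\<exists>\<rho>. (\<forall>i<length Xs. \<rho> i < N (Xs ! i) \<and> ok (Xs ! i) (\<rho> i)) \<and>
      (\<Sum>i<length Xs. wt (Xs ! i) (\<rho> i)) = t)"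
proof
  assume "dsum (map (\<lambda>X. map (wt X) (filter (ok X) [0..<N X])) Xs, t)"
  then obtain xs where xs: "length xs = length Xs" "sum_list xs = t"
    "\<forall>i<length Xs. \<exists>r. r < N (Xs ! i) \<and> ok (Xs ! i) r \<and> xs ! i = wt (Xs ! i) r"
    unfolding dsum_def list_all2_conv_all_nth by (force simp: image_iff)
  then obtain \<rho> where "\<forall>i<length Xs. \<rho> i < N (Xs ! i) \<and> ok (Xs ! i) (\<rho> i) \<and> xs ! i = wt (Xs ! i) (\<rho> i)"
    by metis
  with xs(1,2) show "\<exists>\<rho>. (\<forall>i<length Xs. \<rho> i < N (Xs ! i) \<and> ok (Xs ! i) (\<rho> i)) \<and>
      (\<Sum>i<length Xs. wt (Xs ! i) (\<rho> i)) = t"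
    by (intro exI[of _ \<rho>]) (auto simp: sum_list_sum_nth atLeast0LessThan intro!: sum.cong)
next
  assume "\<exists>\<rho>. (\<forall>i<length Xs. \<rho> i < N (Xs ! i) \<and> ok (Xs ! i) (\<rho> i)) \<and>
      (\<Sum>i<length Xs. wt (Xs ! i) (\<rho> i)) = t"
  then obtain \<rho> where "\<forall>i<length Xs. \<rho> i < N (Xs ! i) \<and> ok (Xs ! i) (\<rho> i)"
      "(\<Sum>i<length Xs. wt (Xs ! i) (\<rho> i)) = t" by blast
  then show "dsum (map (\<lambda>X. map (wt X) (filter (ok X) [0..<N X])) Xs, t)"
    unfolding dsum_def
    by (intro exI[of _ "map (\<lambda>i. wt (Xs ! i) (\<rho> i)) [0..<length Xs]"])
      (auto simp: sum_list_sum_nth atLeast0LessThan list_all2_conv_all_nth)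
qed

text \<open>An arbitrary but fixed numbering, giving each vertex its digit position in a counter.
  The specification and the program refer to the same choice.\<close>

definition index :: "'a set \<Rightarrow> 'a \<Rightarrow> nat" where
  "index X = (SOME h. bij_betw h X {..<card X})"

lemma bij_betw_index:
  assumes "finite X"
  shows "bij_betw (index X) X {..<card X}"
proof -
  have "\<exists>h. bij_betw h X {..<card X}"
    using ex_bij_betw_finite_nat[OF assms] by (simp add: atLeast0LessThan)
  then show ?thesis unfolding index_def by (rule someI_ex)
qed

lemma index_less: "finite X \<Longrightarrow> v \<in> X \<Longrightarrow> index X v < card X"
  using bij_betw_apply[OF bij_betw_index, of X v] by simp

lemma ex_digits_index:
  assumes "finite X" "\<And>v. v \<in> X \<Longrightarrow> f v < b"
  shows "\<exists>x<b ^ card X. \<forall>v\<in>X. digit b x (index X v) = f v"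
proof -
  let ?g = "inv_into X (index X)"
  have bij: "bij_betw (index X) X {..<card X}" using bij_betw_index assms(1) .
  have "f (?g i) < b" if "i < card X" for i
    using assms(2) bij_betw_apply[OF bij_betw_inv_into[OF bij], of i] that by auto
  then obtain x where x: "x < b ^ card X" "\<And>i. i < card X \<Longrightarrow> digit b x i = f (?g i)"
    using ex_digits[of "card X" "\<lambda>i. f (?g i)" b] by blast
  have "digit b x (index X v) = f v" if "v \<in> X" for v
    using x(2)[OF index_less[OF assms(1) that]] bij that
    by (simp add: bij_betw_def)
  then show ?thesis using x(1) by blast
qed

text \<open>\<open>arcs\<close> orients each edge once, so that tests and sums over edges can be
  written out as finite expressions. \<open>nonempty\<close> guarantees that conditions within
  \<open>S\<close> are tested by some part.\<close>

locale separated_graph =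
  fixes H :: "'a graph" and S :: "'a set" and Hs :: "'a set list"
    and arcs pairs :: "('a \<times> 'a) list"
  assumes simple: "simple_graph H"
    and sep: "separator H S Hs"
    and nonempty: "Hs \<noteq> []"
    and distinct_arcs: "distinct arcs"
    and bij_arcs: "bij_betw (\<lambda>(u, v). {u, v}) (set arcs) (snd H)"
    and set_pairs: "set pairs = {(u, v). u \<in> fst H \<and> v \<in> fst H \<and> u \<noteq> v}"
begin

text \<open>The counter \<open>q\<close> encodes the guess in its remainder and the images of \<open>S\<close> in its quotient
  modulo \<open>guess_range n\<close>. A guess \<open>g\<close> for a pair stands for the bit position \<open>g div 2\<close> and the
  bit \<open>g mod 2\<close>.\<close>

definition guess_range :: "nat \<Rightarrow> nat" where
  "guess_range n = (2 * bitlen n) ^ length pairs"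

definition guess :: "nat \<Rightarrow> nat \<Rightarrow> nat \<Rightarrow> nat" where
  "guess n q j = digit (2 * bitlen n) (q mod guess_range n) j"

text \<open>Values outside \<open>S \<union> X\<close> carry no meaning; all uses below are
  restricted to that set. The images of \<open>S\<close> come from \<open>q\<close> alone, hence
  agree in all lists of an instance.\<close>

definition assignment :: "nat \<Rightarrow> nat \<Rightarrow> 'a set \<Rightarrow> nat \<Rightarrow> 'a \<Rightarrow> nat" where
  "assignment n q X r v =
     (if v \<in> S then digit n (q div guess_range n) (index S v) else digit n r (index X v))"

text \<open>The two ends of a pair are tested separately against the common guess, so a pair with
  ends in different parts is handled by two lists that know nothing of each other.\<close>

definition admissible :: "nat set set \<Rightarrow> ('a \<Rightarrow> nat) \<Rightarrow> (nat \<Rightarrow> nat) \<Rightarrow> 'a set \<Rightarrow> bool" where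
  "admissible E f g X \<longleftrightarrow>
     (\<forall>u v. (u, v) \<in> set arcs \<longrightarrow> u \<in> S \<union> X \<longrightarrow> v \<in> S \<union> X \<longrightarrow> {f u, f v} \<in> E) \<and>
     (\<forall>j<length pairs.
        (fst (pairs ! j) \<in> S \<union> X \<longrightarrow>
           f (fst (pairs ! j)) div 2 ^ (g j div 2) mod 2 = g j mod 2) \<and>
        (snd (pairs ! j) \<in> S \<union> X \<longrightarrow>
           f (snd (pairs ! j)) div 2 ^ (g j div 2) mod 2 = 1 - g j mod 2))"

definition inner_arcs :: "('a \<times> 'a) list" where
  "inner_arcs = filter (\<lambda>(u, v). u \<in> S \<and> v \<in> S) arcs"

text \<open>Arcs inside \<open>S\<close> are left out since they would be counted once per part;
  \<open>inst\<close> accounts for them in its target.\<close>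

definition part_arcs :: "'a set \<Rightarrow> ('a \<times> 'a) list" where
  "part_arcs X = filter (\<lambda>(u, v). u \<in> S \<union> X \<and> v \<in> S \<union> X \<and> \<not> (u \<in> S \<and> v \<in> S)) arcs"

definition arcs_weight :: "(nat set \<Rightarrow> int) \<Rightarrow> ('a \<Rightarrow> nat) \<Rightarrow> ('a \<times> 'a) list \<Rightarrow> int" where
  "arcs_weight w f as = (\<Sum>(u, v)\<leftarrow>as. w {f u, f v})"

definition inst :: "nat \<Rightarrow> nat set set \<Rightarrow> (nat set \<Rightarrow> int) \<Rightarrow> int \<Rightarrow> nat \<Rightarrow> dsum_inst" where
  "inst n E w t q =
     (map (\<lambda>X. map (\<lambda>r. arcs_weight w (assignment n q X r) (part_arcs X))
        (filter (\<lambda>r. admissible E (assignment n q X r) (guess n q) X) [0..<n ^ card X])) Hs,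
      t - arcs_weight w (assignment n q {} 0) inner_arcs)"

section \<open>Structure imposed by the separator\<close>

lemma finite_V: "finite (fst H)"
  using simple by (simp add: simple_graph_def)

lemma V_eq: "fst H = S \<union> (\<Union>i<length Hs. Hs ! i)"
proof -
  have "set Hs = (!) Hs ` {..<length Hs}" unfolding set_conv_nth by blast
  moreover have "S \<union> \<Union>(set Hs) = fst H" using sep unfolding separator_def by (rule conjunct1)
  ultimately show ?thesis by (simp only:)
qed

lemma finite_S: "finite S"
  by (rule finite_subset[OF _ finite_V]) (subst V_eq, blast)

lemma finite_part: "i < length Hs \<Longrightarrow> finite (Hs ! i)"
  by (rule finite_subset[OF _ finite_V]) (subst V_eq, blast)

lemma S_part_disjoint:
  assumes "i < length Hs" "v \<in> Hs ! i"
  shows "v \<notin> S"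
proof -
  have "S \<inter> Hs ! i = {}" using sep assms(1) by (simp add: separator_def)
  then show ?thesis using assms(2) by blast
qed

lemma part_unique:
  assumes "i < length Hs" "j < length Hs" "v \<in> Hs ! i" "v \<in> Hs ! j"
  shows "i = j"
proof (rule ccontr)
  assume "i \<noteq> j"
  then have "Hs ! i \<inter> Hs ! j = {}" using sep assms(1,2) by (simp add: separator_def)
  then show False using assms(3,4) by blast
qed

lemma no_edge_between_parts:
  assumes "i < length Hs" "j < length Hs" "u \<in> Hs ! i" "v \<in> Hs ! j" "{u, v} \<in> snd H"
  shows "i = j"
proof (rule ccontr)
  assume "i \<noteq> j"
  then have "\<forall>x\<in>Hs ! i. \<forall>y\<in>Hs ! j. {x, y} \<notin> snd H"
    using sep assms(1,2) by (simp add: separator_def)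
  then show False using assms(3-5) by blast
qed

lemma arc_edge: "(u, v) \<in> set arcs \<Longrightarrow> {u, v} \<in> snd H"
  using bij_betw_apply[OF bij_arcs, of "(u, v)"] by simp

lemma edge_arc:
  assumes "e \<in> snd H" obtains u v where "(u, v) \<in> set arcs" "e = {u, v}"
proof -
  have "e \<in> (\<lambda>(u, v). {u, v}) ` set arcs"
    using assms by (simp only: bij_betw_imp_surj_on[OF bij_arcs])
  then obtain a where "e = (\<lambda>(u, v). {u, v}) a" "a \<in> set arcs" by (rule imageE)
  then show ?thesis using that[of "fst a" "snd a"] by (simp add: case_prod_beta)
qed

lemma vertex_cases:
  assumes "v \<in> fst H"
  obtains "v \<in> S" | i where "i < length Hs" "v \<in> Hs ! i"
  using assms unfolding V_eq by auto

lemma part_subset: "i < length Hs \<Longrightarrow> S \<union> Hs ! i \<subseteq> fst H"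
  unfolding V_eq by auto

lemma vertex_in_part:
  assumes "v \<in> fst H"
  obtains i where "i < length Hs" "v \<in> S \<union> Hs ! i"
  using assms
proof (cases rule: vertex_cases)
  case 1
  then show ?thesis using that[of 0] nonempty by simp
next
  case (2 i)
  then show ?thesis using that[of i] by simp
qed

text \<open>The place where the absence of edges between parts enters: it lets adjacency and weight
  be checked part by part.\<close>

lemma arc_in_part:
  assumes "(u, v) \<in> set arcs"
  obtains i where "i < length Hs" "u \<in> S \<union> Hs ! i" "v \<in> S \<union> Hs ! i"
proof -
  have e: "{u, v} \<in> snd H" using arc_edge[OF assms] .
  then have uv: "u \<in> fst H" "v \<in> fst H" using simple by (auto simp: simple_graph_def)
  show ?thesis
  proof (cases rule: vertex_cases[OF uv(1)])
    case 1
    then show ?thesis using vertex_in_part[OF uv(2)] that by (metis UnI1)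
  next
    case u: (2 i)
    show ?thesis
    proof (cases rule: vertex_cases[OF uv(2)])
      case 1
      then show ?thesis using u that[of i] by simp
    next
      case (2 j)
      then have "i = j" using no_edge_between_parts[OF u(1) 2(1) u(2) 2(2) e] by simp
      then show ?thesis using u 2 that[of i] by simp
    qed
  qed
qed

lemma arcs_weight_eq_sum:
  "arcs_weight w f (filter p arcs) = (\<Sum>(u, v)\<in>{a \<in> set arcs. p a}. w {f u, f v})"
  unfolding arcs_weight_def using distinct_arcs by (simp add: sum_list_distinct_conv_sum_set)

lemma sum_edges_split:
  "(\<Sum>e\<in>snd H. w (f ` e)) =
    arcs_weight w f inner_arcs + (\<Sum>i<length Hs. arcs_weight w f (part_arcs (Hs ! i)))"
proof -
  let ?w = "\<lambda>(u, v). w {f u, f v}"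
  let ?A = "\<lambda>i. set (part_arcs (Hs ! i))"
  have "(\<Sum>e\<in>snd H. w (f ` e)) = (\<Sum>a\<in>set arcs. w (f ` (case a of (u, v) \<Rightarrow> {u, v})))"
    by (rule sum.reindex_bij_betw[OF bij_arcs, symmetric])
  also have "\<dots> = (\<Sum>a\<in>set arcs. ?w a)"
    by (intro sum.cong) auto
  also have "set arcs = set inner_arcs \<union> (\<Union>i<length Hs. ?A i)"
    by (auto simp: inner_arcs_def part_arcs_def elim: arc_in_part)
  also have "(\<Sum>a\<in>\<dots>. ?w a) = (\<Sum>a\<in>set inner_arcs. ?w a) + (\<Sum>a\<in>(\<Union>i<length Hs. ?A i). ?w a)"
    by (rule sum.union_disjoint) (auto simp: inner_arcs_def part_arcs_def)
  \<comment> \<open>Disjoint because such an arc has an end outside \<open>S\<close>, and that end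
    determines the part.\<close>
  also have "(\<Sum>a\<in>(\<Union>i<length Hs. ?A i). ?w a) = (\<Sum>i<length Hs. \<Sum>a\<in>?A i. ?w a)"
    by (rule sum.UNION_disjoint) (auto simp: part_arcs_def dest: part_unique S_part_disjoint)
  finally show ?thesis
    by (simp add: inner_arcs_def part_arcs_def arcs_weight_eq_sum)
qed

lemma arcs_weight_cong:
  assumes "\<And>u v. (u, v) \<in> set as \<Longrightarrow> f u = g u \<and> f v = g v"
  shows "arcs_weight w f as = arcs_weight w g as"
  unfolding arcs_weight_def using assms by (intro arg_cong[of _ _ sum_list] map_cong) auto

lemma admissible_cong:
  assumes "\<And>v. v \<in> S \<union> X \<Longrightarrow> f v = f' v" "\<And>j. j < length pairs \<Longrightarrow> g j = g' j"
  shows "admissible E f g X \<longleftrightarrow> admissible E f' g' X"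
  unfolding admissible_def using assms by (auto cong: conj_cong imp_cong)

lemma admissible_arc:
  "admissible E f g X \<Longrightarrow> (u, v) \<in> set arcs \<Longrightarrow> u \<in> S \<union> X \<Longrightarrow> v \<in> S \<union> X \<Longrightarrow> {f u, f v} \<in> E"
  unfolding admissible_def by (drule conjunct1) blast

lemma admissible_pair:
  assumes "admissible E f g X" "j < length pairs"
  shows "fst (pairs ! j) \<in> S \<union> X \<Longrightarrow>
      f (fst (pairs ! j)) div 2 ^ (g j div 2) mod 2 = g j mod 2"
    and "snd (pairs ! j) \<in> S \<union> X \<Longrightarrow>
      f (snd (pairs ! j)) div 2 ^ (g j div 2) mod 2 = 1 - g j mod 2"
  using assms(1)[unfolded admissible_def, THEN conjunct2] assms(2) by blast+

text \<open>The assignments chosen in the lists agree on \<open>S\<close> and can be glued. The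
  glued map is injective because the common guess forces opposite bits on the images of any two
  vertices.\<close>

lemma inst_sound:
  assumes "q < n ^ card S * guess_range n" "dsum (inst n E w t q)"
  shows "\<exists>f. inj_on f (fst H) \<and> f ` fst H \<subseteq> {..<n} \<and> (\<forall>e\<in>snd H. f ` e \<in> E) \<and>
    (\<Sum>e\<in>snd H. w (f ` e)) = t"
proof -
  obtain \<rho> where \<rho>: "\<And>i. i < length Hs \<Longrightarrow> \<rho> i < n ^ card (Hs ! i)"
    "\<And>i. i < length Hs \<Longrightarrow> admissible E (assignment n q (Hs ! i) (\<rho> i)) (guess n q) (Hs ! i)"
    "(\<Sum>i<length Hs. arcs_weight w (assignment n q (Hs ! i) (\<rho> i)) (part_arcs (Hs ! i))) =
      t - arcs_weight w (assignment n q {} 0) inner_arcs"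
    using assms(2) unfolding inst_def dsum_map_iff by blast
  \<comment> \<open>Unspecified on \<open>S\<close>, but there the value of \<open>f\<close> does
    not depend on the part, by \<open>fS\<close>.\<close>
  define part where "part v = (THE i. i < length Hs \<and> v \<in> Hs ! i)" for v
  have part: "part v = i" if "i < length Hs" "v \<in> Hs ! i" for v i
    unfolding part_def using that part_unique by blast
  define f where "f v = assignment n q (Hs ! part v) (\<rho> (part v)) v" for v
  have fS: "f v = assignment n q X r v" if "v \<in> S" for v X r
    using that by (simp add: f_def assignment_def)
  have f: "f v = assignment n q (Hs ! i) (\<rho> i) v" if "i < length Hs" "v \<in> S \<union> Hs ! i" for v i
  proof (cases "v \<in> S")
    case False
    then have "part v = i" using that part by simp
    then show ?thesis by (simp add: f_def)
  qed (rule fS)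
  have adm: "admissible E f (guess n q) (Hs ! i)" if "i < length Hs" for i
    using \<rho>(2)[OF that] by (subst admissible_cong[OF f[OF that] refl])
  \<comment> \<open>Digits are below \<open>n\<close> only for nonzero \<open>n\<close>. A vertex in
    \<open>S\<close> or in a part gives a positive exponent, and then \<open>n = 0\<close> would
    leave no value for the counter \<open>q\<close> or for \<rho>.\<close>
  have "f v < n" if "v \<in> fst H" for v
  proof (cases "v \<in> S")
    case True
    then have "card S \<noteq> 0" using finite_S by auto
    then have "n > 0" using assms(1) by (cases n) (auto simp: power_0_left)
    then show ?thesis using True by (simp add: f_def assignment_def digit_less)
  next
    case False
    with that obtain i where i: "i < length Hs" "v \<in> Hs ! i" by (blast elim: vertex_cases)
    then have "card (Hs ! i) \<noteq> 0" using finite_part by auto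
    then have "n > 0" using \<rho>(1)[OF i(1)] by (cases n) (auto simp: power_0_left)
    then show ?thesis using False by (simp add: f_def assignment_def digit_less)
  qed
  moreover have "inj_on f (fst H)"
  proof (rule inj_onI, rule ccontr)
    fix u v assume uv: "u \<in> fst H" "v \<in> fst H" "f u = f v" "u \<noteq> v"
    obtain j where j: "j < length pairs" "pairs ! j = (u, v)"
      using uv set_pairs in_set_conv_nth[of "(u, v)" pairs] by auto
    let ?g = "guess n q j"
    obtain i where i: "i < length Hs" "u \<in> S \<union> Hs ! i" using uv(1) by (rule vertex_in_part)
    then have "f u div 2 ^ (?g div 2) mod 2 = ?g mod 2"
      using admissible_pair(1)[OF adm j(1)] j(2) by simp
    moreover obtain i' where i': "i' < length Hs" "v \<in> S \<union> Hs ! i'"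
      using uv(2) by (rule vertex_in_part)
    then have "f v div 2 ^ (?g div 2) mod 2 = 1 - ?g mod 2"
      using admissible_pair(2)[OF adm j(1)] j(2) by simp
    ultimately have "?g mod 2 = 1 - ?g mod 2" using uv(3) by simp
    then show False by presburger
  qed
  moreover have "\<forall>e\<in>snd H. f ` e \<in> E"
  proof
    fix e assume "e \<in> snd H"
    then obtain u v where uv: "(u, v) \<in> set arcs" "e = {u, v}" by (rule edge_arc)
    from uv(1) obtain i where i: "i < length Hs" "u \<in> S \<union> Hs ! i" "v \<in> S \<union> Hs ! i"
      by (rule arc_in_part)
    show "f ` e \<in> E" using admissible_arc[OF adm[OF i(1)] uv(1) i(2,3)] uv(2) by simp
  qed
  moreover have "(\<Sum>e\<in>snd H. w (f ` e)) = t"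
  proof -
    have "arcs_weight w f inner_arcs = arcs_weight w (assignment n q {} 0) inner_arcs"
      by (intro arcs_weight_cong conjI; rule fS) (auto simp: inner_arcs_def)
    moreover have "arcs_weight w f (part_arcs (Hs ! i)) =
        arcs_weight w (assignment n q (Hs ! i) (\<rho> i)) (part_arcs (Hs ! i))" if "i < length Hs" for i
      by (rule arcs_weight_cong) (use f[OF that] in \<open>auto simp: part_arcs_def\<close>)
    ultimately show ?thesis unfolding sum_edges_split using \<rho>(3) by simp
  qed
  ultimately show ?thesis by blast
qed

text \<open>Only one good guess is needed: for every pair take a bit in which the two images differ,
  then encode these guesses and the images of \<open>S\<close> in one \<open>q\<close>.\<close>

lemma inst_complete:
  assumes f: "inj_on f (fst H)" "f ` fst H \<subseteq> {..<n}" "\<And>e. e \<in> snd H \<Longrightarrow> f ` e \<in> E"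
    "(\<Sum>e\<in>snd H. w (f ` e)) = t"
  shows "\<exists>q<n ^ card S * guess_range n. dsum (inst n E w t q)"
proof -
  have fn: "f v < n" if "v \<in> fst H" for v using f(2) that by auto
  have "\<exists>g<2 * bitlen n. f (fst (pairs ! j)) div 2 ^ (g div 2) mod 2 = g mod 2 \<and>
      f (snd (pairs ! j)) div 2 ^ (g div 2) mod 2 = 1 - g mod 2" if "j < length pairs" for j
  proof -
    obtain u v where uv: "pairs ! j = (u, v)" by force
    then have "u \<in> fst H" "v \<in> fst H" "u \<noteq> v" using set_pairs nth_mem[OF that] by auto
    then have "f u < n" "f v < n" "f u \<noteq> f v" using fn f(1) by (auto dest: inj_onD)
    then obtain k where k: "k < bitlen n" "f u div 2 ^ k mod 2 \<noteq> f v div 2 ^ k mod 2"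
      using ex_distinguishing_bit by blast
    define b where "b = f u div 2 ^ k mod 2"
    have b: "b < 2" "f v div 2 ^ k mod 2 = 1 - b" using k(2) by (auto simp: b_def)
    have "2 * k + b < 2 * bitlen n" "(2 * k + b) div 2 = k" "(2 * k + b) mod 2 = b"
      using k(1) b(1) by auto
    then show ?thesis using b(2) uv by (intro exI[of _ "2 * k + b"]) (simp add: b_def)
  qed
  then obtain g where g: "\<And>j. j < length pairs \<Longrightarrow> g j < 2 * bitlen n"
    "\<And>j. j < length pairs \<Longrightarrow> f (fst (pairs ! j)) div 2 ^ (g j div 2) mod 2 = g j mod 2"
    "\<And>j. j < length pairs \<Longrightarrow> f (snd (pairs ! j)) div 2 ^ (g j div 2) mod 2 = 1 - g j mod 2"
    by metis
  obtain y where y: "y < guess_range n" "\<And>j. j < length pairs \<Longrightarrow> digit (2 * bitlen n) y j = g j"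
    using ex_digits[of "length pairs" g "2 * bitlen n"] g(1) unfolding guess_range_def by blast
  obtain x where x: "x < n ^ card S" "\<And>v. v \<in> S \<Longrightarrow> digit n x (index S v) = f v"
    using ex_digits_index[OF finite_S, of f n] fn V_eq by auto
  define q where "q = y + guess_range n * x"
  have "q < guess_range n * (x + 1)" using y(1) by (simp add: q_def)
  also have "\<dots> \<le> guess_range n * n ^ card S" using x(1) by (intro mult_left_mono) auto
  finally have q: "q < n ^ card S * guess_range n" by (simp add: mult.commute)
  have qd: "q div guess_range n = x" "q mod guess_range n = y"
    using y(1) by (auto simp: q_def)
  have "\<exists>r<n ^ card (Hs ! i). \<forall>v\<in>Hs ! i. digit n r (index (Hs ! i) v) = f v"
    if "i < length Hs" for i
    using ex_digits_index[OF finite_part[OF that], of f n] fn V_eq that by auto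
  then obtain \<rho> where \<rho>: "\<And>i. i < length Hs \<Longrightarrow> \<rho> i < n ^ card (Hs ! i)"
    "\<And>i v. i < length Hs \<Longrightarrow> v \<in> Hs ! i \<Longrightarrow> digit n (\<rho> i) (index (Hs ! i) v) = f v"
    by metis
  have aS: "assignment n q X r v = f v" if "v \<in> S" for X r v
    using that x(2) by (simp add: assignment_def qd)
  have a: "assignment n q (Hs ! i) (\<rho> i) v = f v" if "i < length Hs" "v \<in> S \<union> Hs ! i" for i v
    using that aS \<rho>(2) S_part_disjoint[of i v] by (cases "v \<in> S") (auto simp: assignment_def)
  have gg: "guess n q j = g j" if "j < length pairs" for j
    using y(2)[OF that] by (simp add: guess_def qd)
  have "admissible E (assignment n q (Hs ! i) (\<rho> i)) (guess n q) (Hs ! i)" if "i < length Hs" for i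
  proof -
    have "admissible E f g (Hs ! i)"
      unfolding admissible_def
    proof (intro conjI allI impI)
      fix u v assume "(u, v) \<in> set arcs"
      then show "{f u, f v} \<in> E"
        using f(3)[OF arc_edge, of u v] by simp
    qed (use g in auto)
    then show ?thesis by (subst admissible_cong[OF a[OF that] gg])
  qed
  moreover have "(\<Sum>i<length Hs. arcs_weight w (assignment n q (Hs ! i) (\<rho> i)) (part_arcs (Hs ! i))) =
      t - arcs_weight w (assignment n q {} 0) inner_arcs"
  proof -
    have "arcs_weight w (assignment n q {} 0) inner_arcs = arcs_weight w f inner_arcs"
      by (rule arcs_weight_cong) (auto simp: inner_arcs_def aS)
    moreover have "arcs_weight w (assignment n q (Hs ! i) (\<rho> i)) (part_arcs (Hs ! i)) =
        arcs_weight w f (part_arcs (Hs ! i))" if "i < length Hs" for i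
      by (rule arcs_weight_cong) (use a[OF that] in \<open>auto simp: part_arcs_def\<close>)
    ultimately show ?thesis using f(4) unfolding sum_edges_split by simp
  qed
  ultimately have "dsum (inst n E w t q)"
    unfolding inst_def dsum_map_iff using \<rho>(1) by (intro exI[of _ \<rho>]) auto
  then show ?thesis using q by blast
qed

lemma exact_weight_iff_inst:
  assumes "simple_graph ({..<n}, E)"
  shows "exact_weight H ({..<n}, E) w t \<longleftrightarrow>
    (\<exists>q<n ^ card S * guess_range n. dsum (inst n E w t q))"
  unfolding exact_weight_iff_embedding[OF simple assms]
  using inst_sound inst_complete by (auto 4 3)

end

section \<open>The program\<close>

text \<open>Sums instead of maxima: any exponent that dominates all occurring expressions will do,
  and sums reduce the comparison of a piece with the whole program to arithmetic.\<close>

fun com_deg :: "nat \<Rightarrow> com \<Rightarrow> nat" where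
  "com_deg a Skip = 0"
| "com_deg a (Assign r e) = expr_deg a e"
| "com_deg a (Store e1 e2) = expr_deg a e1 + expr_deg a e2"
| "com_deg a (Put i e) = expr_deg a e"
| "com_deg a (Emit e) = expr_deg a e"
| "com_deg a (Seq c1 c2) = com_deg a c1 + com_deg a c2"
| "com_deg a (Cond e c1 c2) = expr_deg a e + com_deg a c1 + com_deg a c2"
| "com_deg a (While e c) = expr_deg a e + com_deg a c"

lemma com_deg_seqs: "c \<in> set cs \<Longrightarrow> com_deg a c \<le> com_deg a (seqs cs)"
  by (induction cs) auto

text \<open>The machine has no shift, so powers of two are tabulated below the input: cell \<open>-1 - k\<close>
  holds \<open>2 ^ k\<close>.\<close>

definition table_memory :: "nat \<Rightarrow> nat set set \<Rightarrow> (nat set \<Rightarrow> int) \<Rightarrow> nat \<Rightarrow> int \<Rightarrow> int" where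
  "table_memory n E w l x =
     (if - int l \<le> x \<and> x < 0 then 2 ^ nat (- 1 - x) else input_memory n E w x)"

text \<open>Register 2 counts the table entries, register 3 is the next one, register 4 is the counter of
  instances, and register 5 that of assignments of the current part.\<close>

definition config ::
    "nat \<Rightarrow> nat set set \<Rightarrow> (nat set \<Rightarrow> int) \<Rightarrow> int \<Rightarrow> nat \<Rightarrow> nat \<Rightarrow> nat \<Rightarrow> int list list \<Rightarrow>
      dsum_inst list \<Rightarrow> state" where
  "config n E w t l q r cu ou =
     \<lparr>reg = (\<lambda>_. 0)(0 := int n, 1 := t, 2 := int l, 3 := 2 ^ l, 4 := int q, 5 := int r),
      mem = table_memory n E w l, cur = cu, out = ou\<rparr>"

lemma config_simps [simp]:
  "reg (config n E w t l q r cu ou) 0 = int n"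
  "reg (config n E w t l q r cu ou) (Suc 0) = t"
  "reg (config n E w t l q r cu ou) 2 = int l"
  "reg (config n E w t l q r cu ou) 3 = 2 ^ l"
  "reg (config n E w t l q r cu ou) 4 = int q"
  "reg (config n E w t l q r cu ou) 5 = int r"
  "mem (config n E w t l q r cu ou) = table_memory n E w l"
  "cur (config n E w t l q r cu ou) = cu"
  "out (config n E w t l q r cu ou) = ou"
  by (simp_all add: config_def)

lemma config_update:
  "(config n E w t l q r cu ou)\<lparr>reg := (reg (config n E w t l q r cu ou))(4 := int q')\<rparr> =
     config n E w t l q' r cu ou"
  "(config n E w t l q r cu ou)\<lparr>reg := (reg (config n E w t l q r cu ou))(5 := int r')\<rparr> =
     config n E w t l q r' cu ou"
  "(config n E w t l q r cu ou)\<lparr>cur := cu'\<rparr> = config n E w t l q r cu' ou"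
  "(config n E w t l q r cu ou)\<lparr>out := ou'\<rparr> = config n E w t l q r cu ou'"
  by (simp_all add: config_def fun_eq_iff)

lemma table_memory_table: "k < l \<Longrightarrow> table_memory n E w l (- 1 - int k) = 2 ^ k"
  by (simp add: table_memory_def)

lemma cell_less:
  fixes u v n :: nat
  assumes "u < n" "v < n"
  shows "u * n + v < n * n"
proof -
  have "u * n + v < (u + 1) * n" using assms by simp
  also have "\<dots> \<le> n * n" using assms by (intro mult_right_mono) auto
  finally show ?thesis .
qed

lemma table_memory_int:
  "table_memory n E w l (int k) =
     (if k < n * n then of_bool ({k div n, k mod n} \<in> E)
      else if k < 2 * n * n \<and> {(k - n * n) div n, (k - n * n) mod n} \<in> E
      then w {(k - n * n) div n, (k - n * n) mod n} else 0)"
  by (simp add: table_memory_def input_memory_def Let_def)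

lemma table_memory_adjacency:
  assumes "u < n" "v < n"
  shows "table_memory n E w l (int u * int n + int v) = of_bool ({u, v} \<in> E)"
proof -
  have "int u * int n + int v = int (u * n + v)" by simp
  then show ?thesis
    using cell_less[OF assms] assms by (simp only: table_memory_int) simp
qed

lemma table_memory_weight:
  assumes "u < n" "v < n"
  shows "table_memory n E w l (int n * int n + (int u * int n + int v)) =
    (if {u, v} \<in> E then w {u, v} else 0)"
proof -
  have "int n * int n + (int u * int n + int v) = int (n * n + (u * n + v))" by simp
  then show ?thesis
    using cell_less[OF assms] assms by (simp only: table_memory_int) simp
qed

text \<open>Only powers with exponent below \<open>bitlen n\<close> are stored, and these are at
  most \<open>n\<close>.\<close>

lemma table_memory_bounded:
  assumes "\<forall>e\<in>E. \<bar>w e\<bar> \<le> int W" "l \<le> bitlen n"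
  shows "\<bar>table_memory n E w l x\<bar> \<le> int (n + W + 2)"
proof (cases "- int l \<le> x \<and> x < 0")
  case True
  then have "nat (- 1 - x) < bitlen n" using assms(2) by linarith
  then have "2 ^ nat (- 1 - x) \<le> n + W + 2"
    using two_power_le_if_less_bitlen[of "nat (- 1 - x)" n] by linarith
  then have "int (2 ^ nat (- 1 - x)) \<le> int (n + W + 2)" by (simp only: of_nat_le_iff)
  then have "2 ^ nat (- 1 - x) \<le> int (n + W + 2)" by (simp only: of_nat_power of_nat_numeral)
  moreover have "table_memory n E w l x = 2 ^ nat (- 1 - x)"
    using True by (simp add: table_memory_def)
  ultimately show ?thesis by (simp only: power_abs abs_numeral)
next
  case False
  have w: "\<bar>w e\<bar> \<le> int (n + W + 2)" if "e \<in> E" for e using assms(1) that by fastforce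
  have "\<bar>input_memory n E w x\<bar> \<le> int (n + W + 2)"
    unfolding input_memory_def Let_def using w by auto
  moreover have "table_memory n E w l x = input_memory n E w x"
    unfolding table_memory_def using False by (rule if_not_P)
  ultimately show ?thesis by (simp only:)
qed

text \<open>The loop stops at the first power of two above \<open>n\<close>, so register 2 ends with
  \<open>bitlen n\<close>, from which the range of the guesses is computed.\<close>

definition table_com :: com where
  "table_com = While (Bin Less (Reg 3) (Bin Add (Reg 0) (Lit 1)))
     (Seq (Store (Bin Sub (Lit (- 1)) (Reg 2)) (Reg 3))
       (Seq (Assign 3 (Bin Mul (Lit 2) (Reg 3))) (Assign 2 (Bin Add (Reg 2) (Lit 1)))))"

section \<open>The program as a function of the graph and its separator\<close>

context separated_graph
begin

text \<open>Recomputed at every use: its size depends on \<open>H\<close> only, so this costs a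
  constant factor and needs no further register.\<close>

definition rangeE :: expr where
  "rangeE = powE (Bin Mul (Lit 2) (Reg 2)) (length pairs)"

definition guessE :: "nat \<Rightarrow> expr" where
  "guessE j = digitE (Bin Mul (Lit 2) (Reg 2)) (Bin Mod (Reg 4) rangeE) j"

definition vertexE :: "'a set \<Rightarrow> 'a \<Rightarrow> expr" where
  "vertexE X v =
     (if v \<in> S then digitE (Reg 0) (Bin Div (Reg 4) rangeE) (index S v)
      else digitE (Reg 0) (Reg 5) (index X v))"

definition bitE :: "expr \<Rightarrow> expr \<Rightarrow> expr" where
  "bitE x g = Bin Mod (Bin Div x (Mem (Bin Sub (Lit (- 1)) (Bin Div g (Lit 2))))) (Lit 2)"

definition cellE :: "'a set \<Rightarrow> 'a \<times> 'a \<Rightarrow> expr" where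
  "cellE X a = Bin Add (Bin Mul (vertexE X (fst a)) (Reg 0)) (vertexE X (snd a))"

definition weightE :: "'a set \<Rightarrow> ('a \<times> 'a) list \<Rightarrow> expr" where
  "weightE X as = sumE (map (\<lambda>a. Mem (Bin Add (Bin Mul (Reg 0) (Reg 0)) (cellE X a))) as)"

text \<open>Membership in \<open>S \<union> X\<close> is decided when the program is built, so only
  conditions that concern this part become code.\<close>

definition pair_tests :: "'a set \<Rightarrow> nat \<Rightarrow> expr list" where
  "pair_tests X j =
     (if fst (pairs ! j) \<in> S \<union> X
      then [Bin Equal (bitE (vertexE X (fst (pairs ! j))) (guessE j)) (Bin Mod (guessE j) (Lit 2))]
      else []) @
     (if snd (pairs ! j) \<in> S \<union> X
      then [Bin Equal (bitE (vertexE X (snd (pairs ! j))) (guessE j))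
              (Bin Sub (Lit 1) (Bin Mod (guessE j) (Lit 2)))]
      else [])"

definition admissibleE :: "'a set \<Rightarrow> expr" where
  "admissibleE X = prodE
     (map (\<lambda>a. Mem (cellE X a)) (filter (\<lambda>(u, v). u \<in> S \<union> X \<and> v \<in> S \<union> X) arcs) @
      concat (map (pair_tests X) [0..<length pairs]))"

text \<open>\<open>Put\<close> takes its list number as a constant, hence one loop per part.
  Resetting register 5 lets all these loops share it.\<close>

definition part_com :: "nat \<Rightarrow> com" where
  "part_com i = Seq
     (While (Bin Less (Reg 5) (powE (Reg 0) (card (Hs ! i))))
       (Seq (Cond (admissibleE (Hs ! i)) (Put i (weightE (Hs ! i) (part_arcs (Hs ! i)))) Skip)
         (Assign 5 (Bin Add (Reg 5) (Lit 1)))))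
     (Assign 5 (Lit 0))"

definition targetE :: expr where
  "targetE = Bin Sub (Reg 1) (weightE {} inner_arcs)"

definition main_com :: com where
  "main_com = While (Bin Less (Reg 4) (Bin Mul (powE (Reg 0) (card S)) rangeE))
     (Seq (seqs (map part_com [0..<length Hs]))
       (Seq (Emit targetE) (Assign 4 (Bin Add (Reg 4) (Lit 1)))))"

definition program :: com where
  "program = Seq (Seq (Assign 3 (Lit 1)) table_com) main_com"

text \<open>With \<open>X = n + W + 2\<close>, the counter of instances is at most
  \<open>X ^ (card S + 2 * length pairs)\<close> because \<open>2 * bitlen n \<le> X ^ 2\<close>;
  the exponent \<open>card (fst H)\<close> covers the counter of each part, and 2 covers register 3,
  which ends at \<open>2 ^ bitlen n \<le> X ^ 2\<close>.\<close>

definition reg_deg :: nat where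
  "reg_deg = card S + 2 * length pairs + card (fst H) + 2"

text \<open>The constant \<open>c\<close> of the reduction. It is fixed before the input, as the
  program is.\<close>

definition word_deg :: nat where
  "word_deg = com_deg reg_deg program"

end

section \<open>Values of the program's expressions on a fixed input\<close>

locale reduction_input = separated_graph H S Hs arcs pairs
  for H :: "'a graph" and S Hs arcs pairs +
  fixes n :: nat and E :: "nat set set" and w :: "nat set \<Rightarrow> int" and t :: int and W :: nat
  assumes graph: "simple_graph ({..<n}, E)"
    and t_bound: "\<bar>t\<bar> \<le> int W"
    and w_bound: "\<forall>e\<in>E. \<bar>w e\<bar> \<le> int W"
begin

abbreviation conf :: "nat \<Rightarrow> nat \<Rightarrow> int list list \<Rightarrow> dsum_inst list \<Rightarrow> state" where
  "conf \<equiv> config n E w t (bitlen n)"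

text \<open>The target is emitted also for images of \<open>S\<close> that violate adjacency, and there the input
  memory yields 0 in place of \<open>w\<close>.\<close>

definition edge_weight :: "nat set \<Rightarrow> int" where
  "edge_weight e = (if e \<in> E then w e else 0)"

abbreviation B :: int where
  "B \<equiv> int (n + W + 2) ^ word_deg"

lemma eval_rangeE [simp]: "eval rangeE (conf q r cu ou) = int (guess_range n)"
  by (simp add: rangeE_def guess_range_def)

lemma eval_guessE [simp]: "eval (guessE j) (conf q r cu ou) = int (guess n q j)"
  unfolding guessE_def guess_def by (rule eval_digitE) (simp_all add: zmod_int)

lemma eval_vertexE [simp]:
  "eval (vertexE X v) (conf q r cu ou) = int (assignment n q X r v)"
  unfolding vertexE_def assignment_def by (auto intro!: eval_digitE simp: zdiv_int)

text \<open>Keeps matrix addresses inside the intended row.\<close>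

lemma assignment_less:
  assumes "q < n ^ card S * guess_range n" "r < n ^ card X" "finite X" "v \<in> S \<union> X"
  shows "assignment n q X r v < n"
proof -
  have "card S \<noteq> 0 \<or> card X \<noteq> 0" using assms(3,4) finite_S by auto
  then have "n > 0" using assms(1,2) by (cases n) (auto simp: power_0_left)
  then show ?thesis by (simp add: assignment_def digit_less)
qed

text \<open>The base of the digits must be nonzero: if \<open>bitlen n = 0\<close> and there is a
  pair, the range of guesses is empty and no \<open>q\<close> exists.\<close>

lemma guess_less:
  assumes "q < n ^ card S * guess_range n" "j < length pairs"
  shows "guess n q j < 2 * bitlen n"
proof -
  have "length pairs \<noteq> 0" using assms(2) by linarith
  then have "guess_range n = 0" if "bitlen n = 0"
    using that by (simp add: guess_range_def)
  then have "bitlen n > 0" using assms(1) by (cases "bitlen n = 0") auto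
  then show ?thesis by (simp add: guess_def digit_less)
qed

text \<open>The bound on \<open>h\<close> ensures that the lookup hits a filled cell of the
  table.\<close>

lemma eval_bitE:
  assumes "eval x (conf q r cu ou) = int k" "eval g (conf q r cu ou) = int h" "h < 2 * bitlen n"
  shows "eval (bitE x g) (conf q r cu ou) = int (k div 2 ^ (h div 2) mod 2)"
proof -
  have "h div 2 < bitlen n" using assms(3) by linarith
  moreover have "int h div 2 = int (h div 2)" by simp
  ultimately have "table_memory n E w (bitlen n) (- 1 - int h div 2) = 2 ^ (h div 2)"
    by (simp only: table_memory_table)
  then show ?thesis
    by (simp add: bitE_def assms(1,2) zdiv_int zmod_int)
qed

lemma eval_weightE:
  assumes "\<And>u v. (u, v) \<in> set as \<Longrightarrow> assignment n q X r u < n \<and> assignment n q X r v < n"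
  shows "eval (weightE X as) (conf q r cu ou) = arcs_weight edge_weight (assignment n q X r) as"
  unfolding weightE_def arcs_weight_def eval_sumE map_map
proof (intro arg_cong[of _ _ sum_list] map_cong refl)
  fix a assume "a \<in> set as"
  moreover obtain u v where "a = (u, v)" by force
  ultimately show "((\<lambda>e. eval e (conf q r cu ou)) \<circ>
      (\<lambda>a. Mem (Bin Add (Bin Mul (Reg 0) (Reg 0)) (cellE X a)))) a =
      (case a of (u, v) \<Rightarrow> edge_weight {assignment n q X r u, assignment n q X r v})"
    using assms[of u v] by (simp add: cellE_def table_memory_weight edge_weight_def)
qed

lemma eval_admissibleE:
  assumes q: "q < n ^ card S * guess_range n" and r: "r < n ^ card X" and X: "finite X"
  shows "eval (admissibleE X) (conf q r cu ou) \<noteq> 0 \<longleftrightarrow>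
    admissible E (assignment n q X r) (guess n q) X"
proof -
  let ?s = "conf q r cu ou" and ?f = "assignment n q X r" and ?g = "guess n q"
  note f = assignment_less[OF q r X]
  have cell: "eval (Mem (cellE X (u, v))) ?s = of_bool ({?f u, ?f v} \<in> E)"
    if "u \<in> S \<union> X" "v \<in> S \<union> X" for u v
    using f[OF that(1)] f[OF that(2)] by (simp add: cellE_def table_memory_adjacency)
  have arcs: "(\<forall>e\<in>set (map (\<lambda>a. Mem (cellE X a)) (filter (\<lambda>(u, v). u \<in> S \<union> X \<and> v \<in> S \<union> X) arcs)).
      eval e ?s \<noteq> 0) \<longleftrightarrow>
      (\<forall>u v. (u, v) \<in> set arcs \<longrightarrow> u \<in> S \<union> X \<longrightarrow> v \<in> S \<union> X \<longrightarrow> {?f u, ?f v} \<in> E)"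
    (is "?L \<longleftrightarrow> ?R")
  proof -
    have "?L \<longleftrightarrow> (\<forall>u v. (u, v) \<in> set arcs \<longrightarrow> u \<in> S \<union> X \<longrightarrow> v \<in> S \<union> X \<longrightarrow>
        eval (Mem (cellE X (u, v))) ?s \<noteq> 0)"
      by (simp del: eval.simps Un_iff) blast
    also have "\<dots> \<longleftrightarrow> ?R" using cell by (metis of_bool_eq_0_iff)
    finally show ?thesis .
  qed
  have tests: "(\<forall>e\<in>set (pair_tests X j). eval e ?s \<noteq> 0) \<longleftrightarrow>
      (fst (pairs ! j) \<in> S \<union> X \<longrightarrow> ?f (fst (pairs ! j)) div 2 ^ (?g j div 2) mod 2 = ?g j mod 2) \<and>
      (snd (pairs ! j) \<in> S \<union> X \<longrightarrow> ?f (snd (pairs ! j)) div 2 ^ (?g j div 2) mod 2 = 1 - ?g j mod 2)"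
    if "j < length pairs" for j
  proof -
    note g = guess_less[OF q that]
    have bit: "eval (bitE (vertexE X v) (guessE j)) ?s = int (?f v div 2 ^ (?g j div 2) mod 2)" for v
      by (rule eval_bitE) (use g in simp_all)
    have mod: "eval (Bin Mod (guessE j) (Lit 2)) ?s = int (?g j mod 2)"
      by (simp add: zmod_int)
    \<comment> \<open>Subtraction is truncated on \<open>nat\<close> but not on the machine; the two
      agree because the remainder is at most 1.\<close>
    have "?g j mod 2 \<le> 1" by simp
    then have neg: "eval (Bin Sub (Lit 1) (Bin Mod (guessE j) (Lit 2))) ?s = int (1 - ?g j mod 2)"
      by (simp only: of_nat_diff eval.simps(4)[of Sub] mod) simp
    have eq: "eval (Bin Equal a b) ?s \<noteq> 0 \<longleftrightarrow> eval a ?s = eval b ?s" for a b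
      by simp
    show ?thesis unfolding pair_tests_def
      by (cases "fst (pairs ! j) \<in> S \<union> X"; cases "snd (pairs ! j) \<in> S \<union> X")
        (simp_all only: if_True if_False append.simps list.set ball_simps eq bit mod neg of_nat_eq_iff
          simp_thms)
  qed
  have "eval (admissibleE X) ?s \<noteq> 0 \<longleftrightarrow>
      (\<forall>e\<in>set (map (\<lambda>a. Mem (cellE X a)) (filter (\<lambda>(u, v). u \<in> S \<union> X \<and> v \<in> S \<union> X) arcs)).
        eval e ?s \<noteq> 0) \<and>
      (\<forall>j<length pairs. \<forall>e\<in>set (pair_tests X j). eval e ?s \<noteq> 0)"
    unfolding admissibleE_def eval_prodE_eq_0_iff set_append set_concat set_map set_upt
      atLeast0LessThan by blast
  then show ?thesis unfolding arcs admissible_def using tests by simp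
qed

end

section \<open>Execution of the program\<close>

lemma config_table_step:
  "(config n E w t l q r cu ou)\<lparr>mem := (table_memory n E w l)(- 1 - int l := 2 ^ l)\<rparr>
     \<lparr>reg := (reg (config n E w t l q r cu ou))(3 := 2 ^ Suc l, 2 := int (Suc l))\<rparr> =
   config n E w t (Suc l) q r cu ou"
proof -
  have "(table_memory n E w l)(- 1 - int l := 2 ^ l) = table_memory n E w (Suc l)"
    by (auto simp: fun_eq_iff table_memory_def)
  then show ?thesis by (simp add: config_def fun_eq_iff)
qed

context separated_graph
begin

text \<open>The constants 20 here and below are slack for loop tests and counter updates. What
  matters is that the value depends on \<open>H\<close> and its separator only.\<close>

definition part_cost :: "'a set \<Rightarrow> nat" where
  "part_cost X = cost (powE (Reg 0) (card X)) + cost (admissibleE X) +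
     cost (weightE X (part_arcs X)) + 20"

definition round_cost :: nat where
  "round_cost = sum_list (map part_cost Hs) + cost targetE + 20"

definition max_part :: "nat \<Rightarrow> nat" where
  "max_part n = Max ((\<lambda>X. n ^ card X) ` set Hs)"

text \<open>The first summand pays for the table. The \<open>+ 1\<close> after a number of rounds
  pays for the last, failing test of a loop and for work outside it.\<close>

definition run_time :: "nat \<Rightarrow> nat" where
  "run_time n =
     20 * (bitlen n + 1) +
     (n ^ card S * guess_range n + 1) *
       (cost (Bin Less (Reg 4) (Bin Mul (powE (Reg 0) (card S)) rangeE)) + 20 +
         round_cost * (length Hs + 1) * (max_part n + 1))"

lemma max_part_ge: "i < length Hs \<Longrightarrow> n ^ card (Hs ! i) \<le> max_part n"
  unfolding max_part_def by (rule Max_ge) auto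

end

section \<open>Effect, step count and word length of each piece of the program\<close>

context reduction_input
begin

text \<open>The counters may equal their limits, because every loop tests its counter once more
  after the last round.\<close>

lemma config_bounded:
  assumes "l \<le> bitlen n" "q \<le> n ^ card S * guess_range n" "r \<le> (n + 1) ^ card (fst H)"
  shows "state_bounded (int (n + W + 2) ^ reg_deg) (config n E w t l q r cu ou)"
proof -
  define X where "X = n + W + 2"
  have X: "2 \<le> X" "n \<le> X" by (auto simp: X_def)
  have ge: "x \<le> X ^ reg_deg" if "x \<le> X ^ k" "k \<le> reg_deg" for x k :: nat
    by (rule order_trans[OF that(1) power_increasing[OF that(2)]]) (use X in simp)
  have "l \<le> X" using assms(1) bitlen_le[of n] X by linarith
  then have l: "l \<le> X ^ reg_deg" using ge[of l 1] by (simp add: reg_deg_def)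
  have n: "n \<le> X ^ reg_deg" using ge[of n 1] X by (simp add: reg_deg_def)
  have XX: "2 * X \<le> X ^ 2" using X by (simp add: power2_eq_square)
  have "2 ^ l \<le> (2::nat) ^ bitlen n" using assms(1) by simp
  also have "\<dots> \<le> 2 * X" using two_power_bitlen_le[of n] by (simp add: X_def)
  finally have "2 ^ l \<le> X ^ 2" using XX by linarith
  then have p: "2 ^ l \<le> X ^ reg_deg" using ge[of "2 ^ l" 2] by (simp add: reg_deg_def)
  have "2 * bitlen n \<le> X ^ 2" using bitlen_le[of n] X XX by linarith
  then have "guess_range n \<le> (X ^ 2) ^ length pairs"
    unfolding guess_range_def by (rule power_mono) simp
  then have "n ^ card S * guess_range n \<le> X ^ card S * (X ^ 2) ^ length pairs"
    using X by (intro mult_mono power_mono) auto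
  also have "\<dots> = X ^ (card S + 2 * length pairs)" by (simp add: power_add power_mult)
  finally have "q \<le> X ^ (card S + 2 * length pairs)" using assms(2) by linarith
  then have q: "q \<le> X ^ reg_deg" by (rule ge) (simp add: reg_deg_def)
  have "(n + 1) ^ card (fst H) \<le> X ^ card (fst H)" by (intro power_mono) (auto simp: X_def)
  then have "r \<le> X ^ card (fst H)" using assms(3) by linarith
  then have r: "r \<le> X ^ reg_deg" by (rule ge) (simp add: reg_deg_def)
  have "W \<le> X ^ reg_deg" using ge[of W 1] by (simp add: X_def reg_deg_def)
  then have t: "\<bar>t\<bar> \<le> int (X ^ reg_deg)" using t_bound by linarith
  have "\<bar>table_memory n E w l x\<bar> \<le> int (X ^ reg_deg)" for x
  proof -
    have "X \<le> X ^ reg_deg" using ge[of X 1] by (simp add: reg_deg_def)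
    then show ?thesis
      using table_memory_bounded[OF w_bound assms(1), of x] unfolding X_def by linarith
  qed
  moreover have "\<bar>reg (config n E w t l q r cu ou) i\<bar> \<le> int (X ^ reg_deg)" for i
  proof -
    have "(2::int) ^ l = int (2 ^ l)" by simp
    then have p': "\<bar>(2::int) ^ l\<bar> \<le> int (X ^ reg_deg)" using p by (simp only: abs_of_nat of_nat_le_iff)
    have nat: "\<bar>int x\<bar> \<le> int (X ^ reg_deg)" if "x \<le> X ^ reg_deg" for x
      using that by (simp only: abs_of_nat of_nat_le_iff)
    have z: "\<bar>0::int\<bar> \<le> int (X ^ reg_deg)" by simp
    show ?thesis unfolding config_def select_convs fun_upd_apply
      by (simp only: nat[OF n] nat[OF l] nat[OF q] nat[OF r] t p' z split: if_split) simp
  qed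
  ultimately show ?thesis
    unfolding state_bounded_def by (simp add: X_def)
qed

lemma fits_config:
  assumes "expr_deg reg_deg e \<le> word_deg"
    "l \<le> bitlen n" "q \<le> n ^ card S * guess_range n" "r \<le> (n + 1) ^ card (fst H)"
  shows "fits B e (config n E w t l q r cu ou)"
  by (rule fits_if_expr_deg[OF _ config_bounded[OF assms(2-4)] assms(1)]) simp

lemma card_part_le: "i < length Hs \<Longrightarrow> card (Hs ! i) \<le> card (fst H)"
  by (intro card_mono finite_V) (use part_subset in auto)

text \<open>The base is \<open>n + 1\<close> because powers of \<open>n\<close> are not monotone in
  the exponent for \<open>n = 0\<close>, where an empty part still has one assignment.\<close>

lemma part_power_le:
  assumes "i < length Hs" "r \<le> n ^ card (Hs ! i)"
  shows "r \<le> (n + 1) ^ card (fst H)"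
proof -
  have "r \<le> (n + 1) ^ card (Hs ! i)"
    using assms(2) power_mono[of n "n + 1" "card (Hs ! i)"] by linarith
  also have "\<dots> \<le> (n + 1) ^ card (fst H)"
    using card_part_le[OF assms(1)] by (intro power_increasing) auto
  finally show ?thesis .
qed

lemma runs_table:
  "runs B (Seq (Assign 3 (Lit 1)) table_com) (initial (length Hs) n E w t) (20 * (bitlen n + 1))
    (conf 0 0 (replicate (length Hs) []) [])"
proof (rule runs_Seq)
  let ?st = "\<lambda>l. config n E w t l 0 0 (replicate (length Hs) []) []"
  \<comment> \<open>With \<open>l = 0\<close> the table is empty, so setting register 3 to
    \<open>2 ^ 0\<close> is all that separates the initial state from the first
    configuration.\<close>
  show "runs B (Assign 3 (Lit 1)) (initial (length Hs) n E w t) 2 (?st 0)"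
  proof (rule runs_Assign)
    show "fits B (Lit 1) (initial (length Hs) n E w t)"
      by (simp add: fits_def)
    show "?st 0 = (initial (length Hs) n E w t)
      \<lparr>reg := (reg (initial (length Hs) n E w t))(3 := eval (Lit 1) (initial (length Hs) n E w t))\<rparr>"
      by (simp add: config_def initial_def table_memory_def fun_eq_iff)
  qed simp
  have deg: "com_deg reg_deg table_com \<le> word_deg"
    by (simp add: word_deg_def program_def)
  note [simp] = table_com_def
  show "runs B table_com (?st 0) (20 * bitlen n + 6) (?st (bitlen n))"
    unfolding table_com_def
  proof (rule runs_While)
    show "fits B (Bin Less (Reg 3) (Bin Add (Reg 0) (Lit 1))) (?st l)" if "l \<le> bitlen n" for l
      by (rule fits_config) (use that deg in simp_all)
    show "eval (Bin Less (Reg 3) (Bin Add (Reg 0) (Lit 1))) (?st l) \<noteq> 0" if "l < bitlen n" for l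
    proof -
      have "int (2 ^ l) \<le> int n" using two_power_le_if_less_bitlen[OF that] by (simp only: of_nat_le_iff)
      then show ?thesis by simp
    qed
    show "eval (Bin Less (Reg 3) (Bin Add (Reg 0) (Lit 1))) (?st (bitlen n)) = 0"
    proof -
      have "int n < int (2 ^ bitlen n)" using less_two_power_bitlen by (simp only: of_nat_less_iff)
      then show ?thesis by simp
    qed
    show "runs B (Seq (Store (Bin Sub (Lit (- 1)) (Reg 2)) (Reg 3))
        (Seq (Assign 3 (Bin Mul (Lit 2) (Reg 3))) (Assign 2 (Bin Add (Reg 2) (Lit 1)))))
        (?st l) 13 (?st (Suc l))" if l: "l < bitlen n" for l
    proof -
      let ?s = "?st l"
      let ?s1 = "?s\<lparr>mem := (mem ?s)(- 1 - int l := 2 ^ l)\<rparr>"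
      let ?s2 = "?s1\<lparr>reg := (reg ?s1)(3 := 2 ^ Suc l)\<rparr>"
      have fits: "fits B e ?s" if "expr_deg reg_deg e \<le> com_deg reg_deg table_com" for e
        by (rule fits_config) (use that deg l in simp_all)
      \<comment> \<open>\<open>?s1\<close> and \<open>?s2\<close> are not configurations, but each
        expression reads only a register that is still unchanged, so the bound at \<open>?s\<close>
        carries over.\<close>
      have "fits B (Bin Mul (Lit 2) (Reg 3)) ?s" "fits B (Bin Add (Reg 2) (Lit 1)) ?s"
        by (rule fits, simp)+
      then have fits': "fits B (Bin Mul (Lit 2) (Reg 3)) ?s1" "fits B (Bin Add (Reg 2) (Lit 1)) ?s2"
        by (simp_all add: fits_def)
      have "runs B (Store (Bin Sub (Lit (- 1)) (Reg 2)) (Reg 3)) ?s 5 ?s1"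
        by (rule runs_Store; (rule fits)?) simp_all
      moreover have "runs B (Assign 3 (Bin Mul (Lit 2) (Reg 3))) ?s1 4 ?s2"
        by (rule runs_Assign) (use fits' in simp_all)
      moreover have "runs B (Assign 2 (Bin Add (Reg 2) (Lit 1))) ?s2 4 (?st (Suc l))"
        by (rule runs_Assign) (use fits' in \<open>simp_all add: add.commute flip: config_table_step\<close>)
      ultimately show ?thesis by
        (intro runs_Seq[where ?T1.0 = 5 and ?T2.0 = 8]
          runs_Seq[where ?T1.0 = 4 and ?T2.0 = 4]) simp_all
    qed
  qed simp
qed simp

lemma part_deg:
  assumes "i < length Hs"
  shows "com_deg reg_deg (part_com i) \<le> word_deg"
proof -
  have "com_deg reg_deg (part_com i) \<le> com_deg reg_deg (seqs (map part_com [0..<length Hs]))"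
    using assms by (intro com_deg_seqs) auto
  then show ?thesis by (simp add: word_deg_def program_def main_com_def)
qed

text \<open>The range \<open>N\<close> is a parameter so that the same term also describes a list
  under construction.\<close>

abbreviation part_list :: "nat \<Rightarrow> 'a set \<Rightarrow> nat \<Rightarrow> int list" where
  "part_list q X N \<equiv> map (\<lambda>r. arcs_weight edge_weight (assignment n q X r) (part_arcs X))
     (filter (\<lambda>r. admissible E (assignment n q X r) (guess n q) X) [0..<N])"

text \<open>After \<open>j\<close> rounds list \<open>i\<close> has grown by the candidates below
  \<open>j\<close>. A rejected candidate is dropped by the filter, so both branches of the
  conditional lead to the same description of the next state.\<close>

lemma runs_part:
  assumes i: "i < length Hs" "i < length cu" and q: "q < n ^ card S * guess_range n"
  shows "runs B (part_com i) (conf q 0 cu ou) (part_cost (Hs ! i) * (max_part n + 1))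
    (conf q 0 (cu[i := cu ! i @ part_list q (Hs ! i) (n ^ card (Hs ! i))]) ou)"
proof -
  let ?X = "Hs ! i"
  let ?N = "n ^ card ?X"
  let ?st = "\<lambda>j. conf q j (cu[i := cu ! i @ part_list q ?X j]) ou"
  let ?c = "Bin Less (Reg 5) (powE (Reg 0) (card ?X))"
  let ?body = "Seq (Cond (admissibleE ?X) (Put i (weightE ?X (part_arcs ?X))) Skip)
         (Assign 5 (Bin Add (Reg 5) (Lit 1)))"
  let ?T = "cost (admissibleE ?X) + cost (weightE ?X (part_arcs ?X)) + 8"
  have fits: "fits B e (conf q j cu' ou)"
    if "expr_deg reg_deg e \<le> com_deg reg_deg (part_com i)" "j \<le> ?N" for e j cu'
    by (rule fits_config) (use that part_deg[OF i(1)] part_power_le[OF i(1)] q in simp_all)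
  have "runs B (While ?c ?body) (?st 0) (?N * (1 + cost ?c + ?T) + (1 + cost ?c)) (?st ?N)"
  proof (rule runs_While)
    show "fits B ?c (?st j)" if "j \<le> ?N" for j
      by (rule fits) (use that in \<open>simp_all add: part_com_def\<close>)
    show "eval ?c (?st j) \<noteq> 0" if "j < ?N" for j
      using that by (simp flip: of_nat_power)
    show "eval ?c (?st ?N) = 0" by simp
    show "runs B ?body (?st j) ?T (?st (Suc j))" if j: "j < ?N" for j
    proof (rule runs_Seq)
      let ?cu = "cu[i := cu ! i @ part_list q ?X (Suc j)]"
      show "runs B (Cond (admissibleE ?X) (Put i (weightE ?X (part_arcs ?X))) Skip) (?st j)
          (cost (admissibleE ?X) + cost (weightE ?X (part_arcs ?X)) + 4) (conf q j ?cu ou)"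
      proof (rule runs_Cond)
        show "fits B (admissibleE ?X) (?st j)"
          by (rule fits) (use j in \<open>simp_all add: part_com_def\<close>)
        note adm = eval_admissibleE[OF q j finite_part[OF i(1)]]
        show "runs B (Put i (weightE ?X (part_arcs ?X))) (?st j)
            (cost (weightE ?X (part_arcs ?X)) + 2) (conf q j ?cu ou)"
          if "eval (admissibleE ?X) (?st j) \<noteq> 0"
        proof (rule runs_Put)
          show "fits B (weightE ?X (part_arcs ?X)) (?st j)"
            by (rule fits) (use j in \<open>simp_all add: part_com_def\<close>)
          have "assignment n q ?X j u < n \<and> assignment n q ?X j v < n"
            if "(u, v) \<in> set (part_arcs ?X)" for u v
            using that assignment_less[OF q j finite_part[OF i(1)]] by (auto simp: part_arcs_def)
          then show "conf q j ?cu ou = (?st j)\<lparr>cur := (cur (?st j))[i := (cur (?st j) ! i) @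
              [eval (weightE ?X (part_arcs ?X)) (?st j)]]\<rparr>"
            using that i(2) by (simp add: adm eval_weightE config_update)
        qed (use i in simp_all)
        show "runs B Skip (?st j) (cost (weightE ?X (part_arcs ?X)) + 2) (conf q j ?cu ou)"
          if "eval (admissibleE ?X) (?st j) = 0"
        proof -
          have "?st j = conf q j ?cu ou" using that adm by auto
          then show ?thesis by (simp add: runs_Skip)
        qed
      qed simp
      show "runs B (Assign 5 (Bin Add (Reg 5) (Lit 1))) (conf q j ?cu ou) 4 (?st (Suc j))"
      proof (rule runs_Assign)
        show "fits B (Bin Add (Reg 5) (Lit 1)) (conf q j ?cu ou)"
          by (rule fits) (use j in \<open>simp_all add: part_com_def\<close>)
        have "eval (Bin Add (Reg 5) (Lit 1)) (conf q j ?cu ou) = int (Suc j)" by simp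
        then show "?st (Suc j) = (conf q j ?cu ou)\<lparr>reg := (reg (conf q j ?cu ou))
            (5 := eval (Bin Add (Reg 5) (Lit 1)) (conf q j ?cu ou))\<rparr>"
          by (simp only: config_update)
      qed simp
    qed simp
  qed simp
  moreover have "runs B (Assign 5 (Lit 0)) (?st ?N) 2 (conf q 0 (cu[i := cu ! i @ part_list q ?X ?N]) ou)"
  proof (rule runs_Assign)
    show "fits B (Lit 0) (?st ?N)" by (simp add: fits_def)
    have "eval (Lit 0) (?st ?N) = int 0" by simp
    then show "conf q 0 (cu[i := cu ! i @ part_list q ?X ?N]) ou =
        (?st ?N)\<lparr>reg := (reg (?st ?N))(5 := eval (Lit 0) (?st ?N))\<rparr>"
      by (simp only: config_update)
  qed simp
  moreover have "?N * (1 + cost ?c + ?T) + (1 + cost ?c) + 2 \<le> part_cost ?X * (max_part n + 1)"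
  proof -
    have "?N * (1 + cost ?c + ?T) + (1 + cost ?c + 2) \<le> ?N * part_cost ?X + part_cost ?X"
      by (intro add_mono mult_left_mono) (simp_all add: part_cost_def)
    also have "\<dots> = part_cost ?X * (?N + 1)" by simp
    also have "\<dots> \<le> part_cost ?X * (max_part n + 1)"
      using max_part_ge[OF i(1)] by (intro mult_left_mono) auto
    finally show ?thesis by simp
  qed
  ultimately have "runs B (part_com i) (?st 0) (part_cost ?X * (max_part n + 1))
      (conf q 0 (cu[i := cu ! i @ part_list q ?X ?N]) ou)"
    unfolding part_com_def by (rule runs_Seq)
  then show ?thesis by simp
qed

lemma inst_eq:
  "inst n E edge_weight t q =
    (map (\<lambda>X. part_list q X (n ^ card X)) Hs,
      t - arcs_weight edge_weight (assignment n q {} 0) inner_arcs)"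
  by (simp add: inst_def)

lemma runs_parts:
  assumes q: "q < n ^ card S * guess_range n"
  shows "runs B (seqs (map part_com [0..<length Hs])) (conf q 0 (replicate (length Hs) []) ou)
    (length Hs * (sum_list (map part_cost Hs) * (max_part n + 1)) + 1)
    (conf q 0 (fst (inst n E edge_weight t q)) ou)"
proof -
  let ?L = "map (\<lambda>X. part_list q X (n ^ card X)) Hs"
  let ?st = "\<lambda>i. conf q 0 (take i ?L @ replicate (length Hs - i) []) ou"
  let ?cs = "map part_com [0..<length Hs]"
  have "runs B (seqs ?cs) (?st 0)
      (length Hs * (sum_list (map part_cost Hs) * (max_part n + 1)) + 1) (?st (length ?cs))"
  proof (rule runs_seqs)
    fix i assume "i < length ?cs"
    then have i: "i < length Hs" by simp
    let ?cu = "take i ?L @ replicate (length Hs - i) []"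
    \<comment> \<open>Position \<open>i\<close> is the first of the lists that are still
      empty.\<close>
    have "length Hs - i = Suc (length Hs - Suc i)" using i by simp
    then have "?cu[i := ?cu ! i @ part_list q (Hs ! i) (n ^ card (Hs ! i))] =
        take (Suc i) ?L @ replicate (length Hs - Suc i) []"
      using i by (simp add: nth_append list_update_append take_Suc_conv_app_nth)
    then have "runs B (part_com i) (?st i) (part_cost (Hs ! i) * (max_part n + 1)) (?st (Suc i))"
      using runs_part[OF i _ q, of ?cu ou] i by (simp only:) simp
    moreover have "part_cost (Hs ! i) \<le> sum_list (map part_cost Hs)"
      using i by (intro member_le_sum_list) auto
    then have "part_cost (Hs ! i) * (max_part n + 1) \<le> sum_list (map part_cost Hs) * (max_part n + 1)"
      by (intro mult_right_mono) auto
    ultimately show "runs B (?cs ! i) (?st i) (sum_list (map part_cost Hs) * (max_part n + 1))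
        (?st (Suc i))"
      using i unfolding runs_def by (auto intro: order_trans)
  qed simp
  then show ?thesis by (simp add: inst_eq)
qed

lemma main_deg: "com_deg reg_deg main_com \<le> word_deg"
  by (simp add: word_deg_def program_def)

lemma runs_round:
  assumes q: "q < n ^ card S * guess_range n"
  shows "runs B
    (Seq (seqs (map part_com [0..<length Hs])) (Seq (Emit targetE) (Assign 4 (Bin Add (Reg 4) (Lit 1)))))
    (conf q 0 (replicate (length Hs) []) ou)
    (round_cost * (length Hs + 1) * (max_part n + 1))
    (conf (Suc q) 0 (replicate (length Hs) []) (ou @ [inst n E edge_weight t q]))"
proof -
  let ?cu = "fst (inst n E edge_weight t q)" and ?es = "replicate (length Hs) []"
  let ?ou = "ou @ [inst n E edge_weight t q]"
  have fits: "fits B e (conf q 0 cu' ou')"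
    if "expr_deg reg_deg e \<le> com_deg reg_deg main_com" for e cu' ou'
    by (rule fits_config) (use that main_deg q in simp_all)
  have "runs B (Emit targetE) (conf q 0 ?cu ou) (1 + cost targetE) (conf q 0 ?es ?ou)"
  proof (rule runs_Emit)
    show "fits B targetE (conf q 0 ?cu ou)"
      by (rule fits) (simp add: main_com_def)
    have "assignment n q {} 0 u < n \<and> assignment n q {} 0 v < n"
      if "(u, v) \<in> set inner_arcs" for u v
      using that assignment_less[OF q, of 0 "{}"] by (auto simp: inner_arcs_def)
    then have "eval targetE (conf q 0 ?cu ou) = snd (inst n E edge_weight t q)"
      by (simp add: targetE_def eval_weightE inst_eq)
    moreover have "length ?cu = length Hs" by (simp add: inst_eq)
    ultimately show "conf q 0 ?es ?ou = (conf q 0 ?cu ou)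
        \<lparr>cur := replicate (length (cur (conf q 0 ?cu ou))) [],
         out := out (conf q 0 ?cu ou) @ [(cur (conf q 0 ?cu ou), eval targetE (conf q 0 ?cu ou))]\<rparr>"
      by (simp only: config_simps config_update prod.collapse)
  qed simp
  moreover have "runs B (Assign 4 (Bin Add (Reg 4) (Lit 1))) (conf q 0 ?es ?ou) 4 (conf (Suc q) 0 ?es ?ou)"
  proof (rule runs_Assign)
    show "fits B (Bin Add (Reg 4) (Lit 1)) (conf q 0 ?es ?ou)"
      by (rule fits) (simp add: main_com_def)
    have "eval (Bin Add (Reg 4) (Lit 1)) (conf q 0 ?es ?ou) = int (Suc q)" by simp
    then show "conf (Suc q) 0 ?es ?ou = (conf q 0 ?es ?ou)
        \<lparr>reg := (reg (conf q 0 ?es ?ou))(4 := eval (Bin Add (Reg 4) (Lit 1)) (conf q 0 ?es ?ou))\<rparr>"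
      by (simp only: config_update)
  qed simp
  moreover have "length Hs * (sum_list (map part_cost Hs) * (max_part n + 1)) + 1 +
      (1 + cost targetE + 4) \<le> round_cost * (length Hs + 1) * (max_part n + 1)"
  proof -
    let ?p = "sum_list (map part_cost Hs)" and ?M = "max_part n + 1"
    have "length Hs * (?p * ?M) \<le> length Hs * (round_cost * ?M)"
      by (intro mult_left_mono mult_right_mono) (auto simp: round_cost_def)
    moreover have "1 + (1 + cost targetE + 4) \<le> round_cost * 1" by (simp add: round_cost_def)
    moreover have "round_cost * 1 \<le> round_cost * ?M" by (intro mult_left_mono) auto
    moreover have "round_cost * (length Hs + 1) * ?M = length Hs * (round_cost * ?M) + round_cost * ?M"
      by (simp add: algebra_simps)
    ultimately show ?thesis by linarith
  qed
  ultimately show ?thesis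
    using runs_parts[OF q] by (blast intro: runs_Seq order_refl)
qed

lemma runs_program:
  "runs B program (initial (length Hs) n E w t) (run_time n)
    (conf (n ^ card S * guess_range n) 0 (replicate (length Hs) [])
      (map (inst n E edge_weight t) [0..<n ^ card S * guess_range n]))"
proof -
  let ?N = "n ^ card S * guess_range n"
  let ?c = "Bin Less (Reg 4) (Bin Mul (powE (Reg 0) (card S)) rangeE)"
  let ?R = "round_cost * (length Hs + 1) * (max_part n + 1)"
  let ?st = "\<lambda>q. conf q 0 (replicate (length Hs) []) (map (inst n E edge_weight t) [0..<q])"
  have "runs B main_com (?st 0) (?N * (1 + cost ?c + ?R) + (1 + cost ?c)) (?st ?N)"
    unfolding main_com_def
  proof (rule runs_While[where T' = ?R])
    show "fits B ?c (?st q)" if "q \<le> ?N" for q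
      by (rule fits_config) (use that main_deg in \<open>simp_all add: main_com_def\<close>)
    have c: "eval ?c (?st q) = of_bool (int q < int ?N)" for q
      by simp
    show "eval ?c (?st q) \<noteq> 0" if "q < ?N" for q
      unfolding c of_nat_less_iff using that by simp
    show "eval ?c (?st ?N) = 0" by simp
  next
    fix q assume "q < ?N"
    from runs_round[OF this, of "map (inst n E edge_weight t) [0..<q]"]
    show "runs B (Seq (seqs (map part_com [0..<length Hs]))
        (Seq (Emit targetE) (Assign 4 (Bin Add (Reg 4) (Lit 1))))) (?st q) ?R (?st (Suc q))"
      by (simp only: upt_Suc_append le0 map_append list.map)
  qed simp
  moreover have "20 * (bitlen n + 1) + (?N * (1 + cost ?c + ?R) + (1 + cost ?c)) \<le> run_time n"
  proof -
    have "?N * (1 + cost ?c + ?R) + (1 + cost ?c) \<le>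
        ?N * (cost ?c + 20 + ?R) + (cost ?c + 20 + ?R)"
      by (rule add_mono[OF mult_left_mono]) linarith+
    also have "\<dots> = (?N + 1) * (cost ?c + 20 + ?R)" by (simp only: add_mult_distrib mult_1)
    finally show ?thesis unfolding run_time_def by (rule add_left_mono)
  qed
  ultimately have "runs B (Seq (Seq (Assign 3 (Lit 1)) table_com) main_com)
      (initial (length Hs) n E w t) (run_time n) (?st ?N)"
    using runs_table by (auto intro: runs_Seq)
  then show ?thesis by (simp add: program_def)
qed

lemma exact_weight_edge_weight:
  "exact_weight H ({..<n}, E) edge_weight t \<longleftrightarrow> exact_weight H ({..<n}, E) w t"
proof -
  have "(\<Sum>e\<in>snd G'. edge_weight e) = (\<Sum>e\<in>snd G'. w e)" if "subgraph G' ({..<n}, E)"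
    for G' :: "nat graph"
    using that by (intro sum.cong) (auto simp: subgraph_def edge_weight_def)
  then show ?thesis unfolding exact_weight_def by (metis (no_types, lifting))
qed

lemma program_correct:
  "\<exists>m s. exec B program (initial (length Hs) n E w t) m s \<and>
     m \<le> run_time n \<and> length (out s) \<le> n ^ card S * guess_range n \<and>
     (\<forall>I\<in>set (out s). length (fst I) = length Hs \<and> (\<forall>L\<in>set (fst I). length L \<le> max_part n)) \<and>
     (exact_weight H ({..<n}, E) w t \<longleftrightarrow> (\<exists>I\<in>set (out s). dsum I))"
proof -
  let ?N = "n ^ card S * guess_range n"
  let ?s = "conf ?N 0 (replicate (length Hs) []) (map (inst n E edge_weight t) [0..<?N])"
  obtain m where m: "m \<le> run_time n" "exec B program (initial (length Hs) n E w t) m ?s"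
    using runs_program unfolding runs_def by blast
  have "length L \<le> max_part n" if "L \<in> set (fst (inst n E edge_weight t q))" for L q
  proof -
    obtain i where i: "i < length Hs" "L = part_list q (Hs ! i) (n ^ card (Hs ! i))"
      using \<open>L \<in> _\<close> by (auto simp: inst_eq in_set_conv_nth)
    have "length L \<le> n ^ card (Hs ! i)"
      unfolding i(2) length_map by (rule order_trans[OF length_filter_le]) simp
    then show ?thesis using max_part_ge[OF i(1), of n] by linarith
  qed
  moreover have "length (fst (inst n E edge_weight t q)) = length Hs" for q
    by (simp add: inst_eq)
  moreover have "exact_weight H ({..<n}, E) w t \<longleftrightarrow> (\<exists>I\<in>set (out ?s). dsum I)"
    using exact_weight_edge_weight exact_weight_iff_inst[OF graph, of edge_weight t] by auto
  ultimately show ?thesis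
    using m by (intro exI[of _ m] exI[of _ ?s]) auto
qed

end

section \<open>Asymptotics\<close>

text \<open>If the bit length is \<open>j + 1\<close>, then \<open>2 ^ j \<le> n\<close> and
  \<open>ln 2 \<ge> 1 / 2\<close> give \<open>j \<le> 2 * ln n\<close>; for
  \<open>n \<ge> 3 > e\<close> the remaining 1 is at most \<open>ln n\<close>.\<close>

lemma bitlen_le_ln:
  assumes "3 \<le> n"
  shows "real (bitlen n) \<le> 4 * ln (real n)"
proof -
  have n: "1 \<le> ln (real n)"
    using assms exp_le by (subst ln_ge_iff) auto
  show ?thesis
  proof (cases "bitlen n")
    case (Suc j)
    then have "2 ^ j \<le> n" using two_power_le_if_less_bitlen[of j n] by simp
    then have "real (2 ^ j) \<le> real n" by (simp only: of_nat_le_iff)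
    then have "ln ((2::real) ^ j) \<le> ln (real n)" using assms by (intro ln_mono) auto
    then have "real j * ln 2 \<le> ln (real n)" by (simp add: ln_realpow)
    moreover have "1 / 2 \<le> ln (2::real)" using exp_half_le2 by (subst ln_ge_iff) auto
    then have "real j * (1 / 2) \<le> real j * ln 2" by (intro mult_left_mono) auto
    ultimately have "real j \<le> 2 * ln (real n)" by linarith
    then show ?thesis using Suc n by simp
  qed (use n in simp)
qed

lemma soft_O_I:
  fixes f g :: "nat \<Rightarrow> real"
  assumes "\<And>n. 3 \<le> n \<Longrightarrow> \<bar>g n\<bar> \<le> C * (f n * ln (real n) ^ k)"
    and "\<And>n. 0 \<le> f n"
  shows "g \<in> soft_O f"
  unfolding soft_O_def
proof (intro CollectI exI)
  show "g \<in> O(\<lambda>n. f n * ln (real n) ^ k)"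
  proof (rule bigoI)
    show "\<forall>\<^sub>F n in at_top. norm (g n) \<le> C * norm (f n * ln (real n) ^ k)"
      using eventually_ge_at_top[of 3]
    proof eventually_elim
      case (elim n)
      then have "0 \<le> f n * ln (real n) ^ k" using assms(2) by simp
      then show ?case using assms(1)[OF elim] by simp
    qed
  qed
qed

context separated_graph
begin

text \<open>The 8 is the factor 2 for the guessed bit times the 4 of
  \<open>bitlen_le_ln\<close>.\<close>

lemma guess_range_le:
  assumes "3 \<le> n"
  shows "real (guess_range n) \<le> 8 ^ length pairs * ln (real n) ^ length pairs"
proof -
  have "real (guess_range n) = (2 * real (bitlen n)) ^ length pairs" by (simp add: guess_range_def)
  also have "\<dots> \<le> (8 * ln (real n)) ^ length pairs"
    using bitlen_le_ln[OF assms] by (intro power_mono) auto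
  finally show ?thesis by (simp add: power_mult_distrib)
qed

lemma number_of_instances_soft_O:
  "(\<lambda>n. real (n ^ card S * guess_range n)) \<in> soft_O (\<lambda>n. real (n ^ card S))"
proof (rule soft_O_I)
  fix n :: nat assume n: "3 \<le> n"
  have "real (n ^ card S) * real (guess_range n) \<le>
      real (n ^ card S) * (8 ^ length pairs * ln (real n) ^ length pairs)"
    using guess_range_le[OF n] by (intro mult_left_mono) auto
  then show "\<bar>real (n ^ card S * guess_range n)\<bar> \<le>
      8 ^ length pairs * (real (n ^ card S) * ln (real n) ^ length pairs)"
    by (simp add: mult_ac)
qed simp

lemma run_time_soft_O:
  "(\<lambda>n. real (run_time n)) \<in> soft_O (\<lambda>n. real (n ^ card S * max_part n))"
proof -
  define P where "P = length pairs"
  define c where "c = real (cost (Bin Less (Reg 4) (Bin Mul (powE (Reg 0) (card S)) rangeE)) + 20)"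
  define d where "d = real (round_cost * (length Hs + 1))"
  show ?thesis
  proof (rule soft_O_I)
    fix n :: nat assume n: "3 \<le> n"
    define l where "l = ln (real n)"
    define N where "N = real (n ^ card S)"
    define M where "M = real (max_part n)"
    \<comment> \<open>\<open>P\<close> logarithms come from the guesses; one more lets
      \<open>K\<close> dominate the construction of the table as well. All factors are at least 1,
      which absorbs the additive constants.\<close>
    define K where "K = N * M * l ^ (P + 1)"
    have l: "1 \<le> l" unfolding l_def using n exp_le by (subst ln_ge_iff) auto
    have N: "1 \<le> N" unfolding N_def using n by simp
    have "1 \<le> n ^ card (Hs ! 0)" using n by simp
    then have "1 \<le> max_part n" using max_part_ge[of 0 n] nonempty by (simp add: order_trans)
    then have M: "1 \<le> M" by (simp add: M_def)
    have NM: "1 \<le> N * M" using mult_mono[OF N M] N by simp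
    have lP: "1 \<le> l ^ P" using l by simp
    have lK: "l \<le> K"
    proof -
      have "1 * l \<le> (N * M * l ^ P) * l"
        using mult_mono[OF NM lP] NM l by (intro mult_right_mono) auto
      then show ?thesis by (simp add: K_def mult_ac)
    qed
    have G: "N * real (guess_range n) + 1 \<le> (8 ^ P + 1) * (N * l ^ (P + 1))"
    proof -
      have "N * real (guess_range n) \<le> N * (8 ^ P * l ^ P)"
        using guess_range_le[OF n] N unfolding P_def l_def by (intro mult_left_mono) auto
      moreover have "1 \<le> N * l ^ P" using mult_mono[OF N lP] N by simp
      ultimately have "N * real (guess_range n) + 1 \<le> (8 ^ P + 1) * (N * l ^ P)"
        by (simp add: algebra_simps)
      also have "\<dots> \<le> (8 ^ P + 1) * (N * l ^ (P + 1))"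
        using l N by (intro mult_left_mono power_increasing) auto
      finally show ?thesis .
    qed
    have cd: "0 \<le> c" "0 \<le> d" by (auto simp: c_def d_def)
    have R: "c + d * (M + 1) \<le> (c + 2 * d) * M"
    proof -
      have "c * 1 \<le> c * M" "d * 1 \<le> d * M" using M cd by (intro mult_left_mono; simp)+
      then show ?thesis by (simp add: algebra_simps)
    qed
    have "real (run_time n) = 20 * (real (bitlen n) + 1) +
        (N * real (guess_range n) + 1) * (c + d * (M + 1))"
      by (simp add: run_time_def N_def M_def c_def d_def algebra_simps)
    also have "\<dots> \<le> 20 * (5 * K) + ((8 ^ P + 1) * (N * l ^ (P + 1))) * ((c + 2 * d) * M)"
    proof (intro add_mono mult_left_mono)
      show "real (bitlen n) + 1 \<le> 5 * K"
        using bitlen_le_ln[OF n] l lK unfolding l_def by linarith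
      show "(N * real (guess_range n) + 1) * (c + d * (M + 1)) \<le>
          ((8 ^ P + 1) * (N * l ^ (P + 1))) * ((c + 2 * d) * M)"
        using G R N M l cd by (intro mult_mono) auto
    qed simp
    also have "\<dots> = (100 + (8 ^ P + 1) * (c + 2 * d)) * (N * M * l ^ (P + 1))"
      by (simp add: K_def algebra_simps)
    finally show "\<bar>real (run_time n)\<bar> \<le> (100 + (8 ^ P + 1) * (c + 2 * d)) *
        (real (n ^ card S * max_part n) * ln (real n) ^ (P + 1))"
      by (simp add: N_def M_def l_def)
  qed simp
qed

lemma reduction:
  "exact_weight_reduces_to_dsum H (length Hs) (\<lambda>n. n ^ card S) max_part"
  unfolding exact_weight_reduces_to_dsum_def
proof (rule exI[of _ program], rule exI[of _ word_deg],
    rule exI[of _ "\<lambda>n. real (n ^ card S * guess_range n)"],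
    rule exI[of _ "\<lambda>n. real (run_time n)"], intro conjI allI impI)
  show "(\<lambda>n. real (n ^ card S * guess_range n)) \<in> soft_O (\<lambda>n. real (n ^ card S))"
    by (rule number_of_instances_soft_O)
  show "(\<lambda>n. real (run_time n)) \<in> soft_O (\<lambda>n. real (n ^ card S * max_part n))"
    by (rule run_time_soft_O)
  fix n :: nat and E :: "nat set set" and w :: "nat set \<Rightarrow> int" and t :: int and W :: nat
  assume "simple_graph ({..<n}, E)" "\<bar>t\<bar> \<le> int W" "\<forall>e\<in>E. \<bar>w e\<bar> \<le> int W"
  then interpret reduction_input H S Hs arcs pairs n E w t W by unfold_locales
  show "\<exists>m s. exec (int ((n + W + 2) ^ word_deg)) program (initial (length Hs) n E w t) m s \<and>
      real m \<le> real (run_time n) \<and>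
      real (length (out s)) \<le> real (n ^ card S * guess_range n) \<and>
      (\<forall>I\<in>set (out s). length (fst I) = length Hs \<and> (\<forall>L\<in>set (fst I). length L \<le> max_part n)) \<and>
      (exact_weight H ({..<n}, E) w t \<longleftrightarrow> (\<exists>I\<in>set (out s). dsum I))"
    using program_correct by (simp only: of_nat_le_iff of_nat_power)
qed

end

theorem theorem3:
  fixes H :: "'a graph" and S :: "'a set" and Hs :: "'a set list"
  assumes "simple_graph H"
    and "separator H S Hs"
    and "length Hs \<ge> 1"
  shows "exact_weight_reduces_to_dsum H (length Hs)
           (\<lambda>n. n ^ card S) (\<lambda>n. Max ((\<lambda>X. n ^ card X) ` set Hs))"
proof -
  have fin: "finite (fst H)" using assms(1) by (simp add: simple_graph_def)
  have "snd H \<subseteq> Pow (fst H)" using assms(1) by (auto simp: simple_graph_def)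
  then have "finite (snd H)" using fin by (simp add: finite_subset)
  then obtain es where es: "set es = snd H" "distinct es" using finite_distinct_list by blast
  let ?edge = "\<lambda>(u, v). {u, v}"
  have "\<forall>e\<in>snd H. \<exists>a. ?edge a = e"
  proof
    fix e assume "e \<in> snd H"
    then have "card e = 2" using assms(1) by (simp add: simple_graph_def)
    then obtain u v where "e = {u, v}" by (meson card_2_iff)
    then show "\<exists>a. ?edge a = e" by (intro exI[of _ "(u, v)"]) simp
  qed
  \<comment> \<open>Each edge gets an arbitrary orientation. Forgetting it is a left inverse, so
    arcs and edges correspond bijectively.\<close>
  then have "\<exists>arc. \<forall>e\<in>snd H. ?edge (arc e) = e" by (rule bchoice)
  then obtain arc where "\<forall>e\<in>snd H. ?edge (arc e) = e" by (rule exE)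
  then have arc: "?edge (arc e) = e" if "e \<in> snd H" for e using that by (rule bspec)
  then have inj: "inj_on arc (snd H)" by (rule inj_on_inverseI)
  have bij: "bij_betw ?edge (arc ` snd H) (snd H)"
  proof (rule bij_betw_imageI)
    show "inj_on ?edge (arc ` snd H)" using arc by (intro inj_on_inverseI[where g = arc]) (elim imageE, simp)
    show "?edge ` arc ` snd H = snd H" unfolding image_image using arc by (simp cong: image_cong)
  qed
  have "finite {(u, v). u \<in> fst H \<and> v \<in> fst H \<and> u \<noteq> v}"
    by (rule finite_subset[OF _ finite_cartesian_product[OF fin fin]]) auto
  then obtain pairs where "set pairs = {(u, v). u \<in> fst H \<and> v \<in> fst H \<and> u \<noteq> v}"
    using finite_list by blast
  moreover have "distinct (map arc es)" using es inj by (simp add: distinct_map)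
  moreover have "bij_betw ?edge (set (map arc es)) (snd H)" using bij es(1) by simp
  moreover have "Hs \<noteq> []" using assms(3) by auto
  ultimately interpret separated_graph H S Hs "map arc es" pairs
    using assms(1,2) by unfold_locales
  show ?thesis using reduction unfolding max_part_def .
qed

end
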